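(* Let $r\in\mathbb{N}$, $r\ge 1$, and suppose that $p=r+1$ and $N=2r+1$. For $0<R<\overline{R}$ let $\lambda_k(R,\overline{R})$, $q_{R,\overline{R}}$, $\bar q_-(R,\overline{R})$, $\bar q_+(R,\overline{R})$ and $\pi_p$ be as defined in the context. Then $$\lim_{R\to+\infty}\bar q_+(R,R+1)=\lim_{R\to+\infty}\bar q_-(R,R+1)=1.$$ In particular, for every integer $k\ge 1$, $$\lim_{R\to+\infty}\lambda_k(R,R+1)=(k\pi_p)^p=(\pi_{r+1}k)^{r+1}.$$
   Context: Let $N\in\mathbb{N}$ be the space dimension, $1<p<N$, and $0<R<\overline{R}$. Let $\Omega_{R,\overline{R}}=\{x\in\mathbb{R}^N: R<|x|<\overline{R}\}$. The number $\lambda_k=\lambda_k(R,\overline{R})$, $k\ge 1$, denotes the $k$-th radial eigenvalue of the Dirichlet problem $-\Delta_p u=\lambda|u|^{p-2}u$ in $\Omega_{R,\overline{R}}$, $u=0$ on $\partial\Omega_{R,\overline{R}}$, where $\Delta_p u=\operatorname{div}(|\nabla u|^{p-2}\nabla u)$. Equivalently, it is the $k$-th eigenvalue of the one-dimensional problem (with radial variable $\rho$) $$(\rho^{N-1}|u'(\rho)|^{p-2}u'(\rho))'+\lambda\,\rho^{N-1}|u(\rho)|^{p-2}u(\rho)=0\ \text{ in }(R,\overline{R}),\qquad u(R)=u(\overline{R})=0,$$ which is also (by a change of variables) the $k$-th eigenvalue of $$(|v'(t)|^{p-2}v'(t))'+\lambda\,q_{R,\overline{R}}(t)|v(t)|^{p-2}v(t)=0\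 \text{ in }(0,1),\qquad v(0)=v(1)=0.$$ Here an eigenvalue is a $\lambda$ for which a nontrivial solution exists; the eigenvalues form a sequence $0<\lambda_1<\lambda_2<\cdots$ with $\lambda_k\to\infty$, and they are counted in this increasing order. The expression $|s|^{p-2}s$ is understood as $0$ at $s=0$. The weight $q_{R,\overline{R}}:[0,1]\to(0,\infty)$ is defined, for $N>p$, by $$q_{R,\overline{R}}(t)=\left(\frac{p-1}{N-p}\right)^{p}\frac{A^{\frac{(p-1)p}{N-p}}}{(B-t)^{\frac{p(N-1)}{N-p}}},\quad A=\frac{(R\overline{R})^{\frac{N-p}{p-1}}}{\overline{R}^{\frac{N-p}{p-1}}-R^{\frac{N-p}{p-1}}},\quad B=\frac{\overline{R}^{\frac{N-p}{p-1}}}{\overline{R}^{\frac{N-p}{p-1}}-R^{\frac{N-p}{p-1}}}.$$ Moreover, $$\bar q_-(R,\overline{R})=\int_0^1\min\{1,q_{R,\overline{R}}(t)\}\,dt,\qquad \bar q_+(R,\overline{R})=\int_0^1\max\{1,q_{R,\overline{R}}(t)\}\,dt,$$ and $$\pi_p=\frac{2\pi(p-1)^{1/p}}{p\sin(\pi/p)}.$$ *)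

theory Defs
  imports "HOL-Analysis.Analysis"
begin

definition annulus :: "real \<Rightarrow> real \<Rightarrow> 'a::real_normed_vector set" where
  "annulus R S = {x. R < norm x \<and> norm x < S}"

definition has_divergence :: "('a::euclidean_space \<Rightarrow> 'a) \<Rightarrow> real \<Rightarrow> 'a \<Rightarrow> bool" where
  "has_divergence F d x \<longleftrightarrow>
     (\<exists>F'. (F has_derivative F') (at x) \<and> d = (\<Sum>b\<in>Basis. F' b \<bullet> b))"

text \<open>
  Classical solutions of \<open>- div (|grad u|^(p-2) grad u) = \<lambda> |u|^(p-2) u\<close> in \<open>\<Omega>\<close> with
  \<open>u = 0\<close> on the boundary: \<open>u\<close> is continuous up to the boundary and continuously
  differentiable in \<open>\<Omega>\<close>, and the flux (not \<open>grad u\<close> itself, which need not be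
  differentiable where it vanishes) is differentiable in \<open>\<Omega>\<close>.  Since \<open>0 powr a = 0\<close> for
  every \<open>a\<close>, the expressions \<open>|s|^(p-2) s\<close> are \<open>0\<close> at \<open>s = 0\<close> also when \<open>p \<le> 2\<close>.
\<close>

definition p_laplace_dirichlet_solution ::
    "real \<Rightarrow> real \<Rightarrow> 'a::euclidean_space set \<Rightarrow> ('a \<Rightarrow> real) \<Rightarrow> bool" where
  "p_laplace_dirichlet_solution p lam \<Omega> u \<longleftrightarrow>
     continuous_on (closure \<Omega>) u \<and> (\<forall>x\<in>frontier \<Omega>. u x = 0) \<and>
     (\<exists>g. continuous_on \<Omega> g \<and>
          (\<forall>x\<in>\<Omega>. GDERIV u x :> g x) \<and>
          (\<forall>x\<in>\<Omega>. \<exists>d. has_divergence (\<lambda>y. (norm (g y) powr (p - 2)) *\<^sub>R g y) d x \<and>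
                     - d = lam * (\<bar>u x\<bar> powr (p - 2) * u x)))"

definition radial_on :: "'a::real_normed_vector set \<Rightarrow> ('a \<Rightarrow> 'b) \<Rightarrow> bool" where
  "radial_on \<Omega> u \<longleftrightarrow> (\<forall>x\<in>\<Omega>. \<forall>y\<in>\<Omega>. norm x = norm y \<longrightarrow> u x = u y)"

text \<open>The space, and hence the dimension \<open>N = DIM('a)\<close>, is passed as a type argument.\<close>

definition radial_eigenvalues ::
    "'a::euclidean_space itself \<Rightarrow> real \<Rightarrow> real \<Rightarrow> real \<Rightarrow> real set" where
  "radial_eigenvalues T p R S =
     {lam. \<exists>u :: 'a \<Rightarrow> real.
        p_laplace_dirichlet_solution p lam (annulus R S) u \<and>
        radial_on (annulus R S) u \<and> (\<exists>x\<in>annulus R S. u x \<noteq> 0)}"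

text \<open>\<open>k = 1, 2, \<dots>\<close>: exactly \<open>k - 1\<close> radial eigenvalues lie strictly below the \<open>k\<close>-th one.\<close>

definition radial_eigenvalue ::
    "'a::euclidean_space itself \<Rightarrow> real \<Rightarrow> nat \<Rightarrow> real \<Rightarrow> real \<Rightarrow> real" where
  "radial_eigenvalue T p k R S =
     (THE lam. lam \<in> radial_eigenvalues T p R S \<and>
        finite {mu \<in> radial_eigenvalues T p R S. mu < lam} \<and>
        Suc (card {mu \<in> radial_eigenvalues T p R S. mu < lam}) = k)"

definition weight_A :: "real \<Rightarrow> real \<Rightarrow> real \<Rightarrow> real \<Rightarrow> real" where
  "weight_A N p R S = (R * S) powr ((N - p) / (p - 1)) /
     (S powr ((N - p) / (p - 1)) - R powr ((N - p) / (p - 1)))"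

definition weight_B :: "real \<Rightarrow> real \<Rightarrow> real \<Rightarrow> real \<Rightarrow> real" where
  "weight_B N p R S = S powr ((N - p) / (p - 1)) /
     (S powr ((N - p) / (p - 1)) - R powr ((N - p) / (p - 1)))"

definition weight_q :: "real \<Rightarrow> real \<Rightarrow> real \<Rightarrow> real \<Rightarrow> real \<Rightarrow> real" where
  "weight_q N p R S t = ((p - 1) / (N - p)) powr p *
     (weight_A N p R S powr ((p - 1) * p / (N - p)) /
      (weight_B N p R S - t) powr (p * (N - 1) / (N - p)))"

definition q_minus :: "real \<Rightarrow> real \<Rightarrow> real \<Rightarrow> real \<Rightarrow> real" where
  "q_minus N p R S = integral {0..1} (\<lambda>t. min 1 (weight_q N p R S t))"

definition q_plus :: "real \<Rightarrow> real \<Rightarrow> real \<Rightarrow> real \<Rightarrow> real" where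
  "q_plus N p R S = integral {0..1} (\<lambda>t. max 1 (weight_q N p R S t))"

definition pi_p :: "real \<Rightarrow> real" where
  "pi_p p = 2 * pi * (p - 1) powr (1 / p) / (p * sin (pi / p))"

end

theory Submission
  imports Defs
begin

text \<open>
  For \<open>p = r + 1\<close> and \<open>N = 2 r + 1\<close> a radial solution \<open>u x = v (norm x)\<close> corresponds to a solution of
  \<open>v' = a root r z\<close>, \<open>z' = - \<lambda> b phi r v\<close> on \<open>[R, S]\<close> with \<open>phi r s = \<bar>s\<bar> ^ (r - 1) s\<close>,
  \<open>a = (R / \<rho>) ^ 2\<close> and \<open>b = (\<rho> / R) ^ (2 r)\<close>.  A Pruefer transformation compatible with the
  homogeneity, \<open>v = P sin \<beta>\<close> and \<open>z = (m P) ^ r cos \<beta>\<close> with \<open>\<lambda> = r m ^ (r + 1)\<close>, uses the ordinary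
  sine and cosine and still gives an angle equation that is Lipschitz in \<open>\<beta>\<close>.  Its value at \<open>S\<close> is
  continuous and strictly increasing in \<open>m\<close>, and the \<open>k\<close>-th eigenvalue is given by \<open>\<beta> S = k pi\<close>.
  Measured by the arc length of the generalised sine, whose half period is a Beta integral, the
  angle grows at a rate between \<open>m min a b\<close> and \<open>m max a b\<close>.  On \<open>[R, R + 1]\<close> both coefficients tend
  to \<open>1\<close> uniformly, which squeezes the eigenvalue.
\<close>

section \<open>Scalar differential equations\<close>

text \<open>Existence is drawn from the scalar angle equation, with the amplitude recovered by a
  quadrature; uniqueness is claimed only for the ratio of v and z, which already determines the
  zeros of v. Both are needed because the k-th eigenvalue is defined by counting: each m with angle
  k pi must give an eigenvalue, and every eigenvalue must arise from such an m. The relation N - 1 =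
  2 (p - 1) makes \<rho>^(N-1) = \<rho>^(2r), whose inverse (p-1)-th root is \<rho>^(-2), so all
  coefficients are integer powers. The factor r = p - 1 in \<lambda> = r m^(r+1) makes the arc
  length grow at the constant rate m when a = b = 1, and it reappears as the p-th power of the
  factor (p-1)^(1/p) of pi_p. The eigenvalue limit rests on the uniform closeness of a and b to 1,
  the limits of the averaged weights on separate pointwise bounds.\<close>

lemma gronwall_abs:
  fixes D D' :: "real \<Rightarrow> real"
  assumes "continuous_on {A..B} D"
    and der: "\<And>t. A < t \<Longrightarrow> t < B \<Longrightarrow> (D has_real_derivative D' t) (at t)"
    and bd: "\<And>t. A < t \<Longrightarrow> t < B \<Longrightarrow> \<bar>D' t\<bar> \<le> e + K * \<bar>D t\<bar>"
    and "D A = 0" "K \<ge> 0" "e \<ge> 0" and t: "A \<le> t" "t \<le> B"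
  shows "\<bar>D t\<bar> \<le> e * exp ((2 * K + 1) * (B - A))"
proof -
  \<comment> \<open>Squaring avoids differentiating the absolute value. Adding e^2 absorbs the
    inhomogeneity through 2 |D| e \<le> D^2 + e^2, which costs the extra 1 in the exponent 2 K +
    1.\<close>
  define L where "L = 2 * K + 1"
  define E where "E = (\<lambda>t. (D t ^ 2 + e ^ 2) * exp (- (L * (t - A))))"
  have "E t \<le> E A"
  proof (rule DERIV_nonpos_imp_decreasing_open[OF t(1)])
    show "continuous_on {A..t} E"
      unfolding E_def using t
      by (intro continuous_intros continuous_on_subset[OF assms(1)]) auto
    fix x assume x: "A < x" "x < t"
    then have dx: "(D has_real_derivative D' x) (at x)" and bx: "\<bar>D' x\<bar> \<le> e + K * \<bar>D x\<bar>"
      using der bd t by auto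
    have "(E has_real_derivative (2 * D x * D' x - L * (D x ^ 2 + e ^ 2)) * exp (- (L * (x - A)))) (at x)"
      unfolding E_def
      by (rule derivative_eq_intros dx refl | simp add: algebra_simps)+
    moreover have "2 * D x * D' x - L * (D x ^ 2 + e ^ 2) \<le> 0"
    proof -
      have "2 * D x * D' x \<le> 2 * (\<bar>D x\<bar> * \<bar>D' x\<bar>)"
        by (metis abs_ge_self abs_mult mult.assoc mult_left_mono zero_le_numeral)
      also have "\<dots> \<le> 2 * (\<bar>D x\<bar> * (e + K * \<bar>D x\<bar>))"
        using bx by (intro mult_left_mono) auto
      also have "\<dots> = 2 * \<bar>D x\<bar> * e + 2 * K * (D x)^2"
        by (simp add: algebra_simps power2_eq_square)
      also have "2 * \<bar>D x\<bar> * e \<le> (D x)^2 + e^2"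
        using zero_le_power2[of "\<bar>D x\<bar> - e"] by (simp add: power2_diff)
      also have "(D x)^2 + e^2 + 2 * K * (D x)^2 \<le> L * (D x ^ 2 + e ^ 2)"
        using \<open>K \<ge> 0\<close> by (simp add: L_def algebra_simps)
      finally show ?thesis by simp
    qed
    ultimately show "\<exists>y. (E has_real_derivative y) (at x) \<and> y \<le> 0"
      by (meson exp_ge_zero mult_nonpos_nonneg)
  qed
  then have "(D t ^ 2 + e ^ 2) * exp (- (L * (t - A))) \<le> e ^ 2"
    using \<open>D A = 0\<close> by (simp add: E_def)
  then have "(D t ^ 2 + e ^ 2) / exp (L * (t - A)) \<le> e ^ 2"
    by (simp only: exp_minus divide_inverse)
  then have "D t ^ 2 + e ^ 2 \<le> e ^ 2 * exp (L * (t - A))"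
    by (subst (asm) pos_divide_le_eq) (rule exp_gt_zero)
  moreover have "exp (L * (t - A)) \<le> exp (L * (B - A)) ^ 2"
  proof -
    have "L * (t - A) \<le> L * (B - A)" "0 \<le> L * (B - A)"
      using t \<open>K \<ge> 0\<close> by (auto simp: L_def intro!: mult_left_mono)
    then show ?thesis
      unfolding exp_double[symmetric] by simp
  qed
  ultimately have "D t ^ 2 + e ^ 2 \<le> (e * exp (L * (B - A)))^2"
    unfolding power_mult_distrib by (meson mult_left_mono order_trans zero_le_power2)
  then have "\<bar>D t\<bar> ^ 2 \<le> (e * exp (L * (B - A)))^2"
    unfolding power2_abs using zero_le_power2[of e] by linarith
  then have "\<bar>D t\<bar> \<le> e * exp (L * (B - A))"
    by (rule power2_le_imp_le) (use \<open>e \<ge> 0\<close> in simp)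
  then show ?thesis by (simp only: L_def)
qed

text \<open>Gronwall with e = 0, applied forwards from s and, after the reflection x -> -x,
  backwards from s.\<close>

lemma zero_propagates:
  fixes D D' :: "real \<Rightarrow> real"
  assumes c: "continuous_on {A..B} D"
    and der: "\<And>t. A < t \<Longrightarrow> t < B \<Longrightarrow> (D has_real_derivative D' t) (at t)"
    and bd: "\<And>t. A < t \<Longrightarrow> t < B \<Longrightarrow> \<bar>D' t\<bar> \<le> K * \<bar>D t\<bar>"
    and s: "A \<le> s" "s \<le> B" "D s = 0" and "K \<ge> 0" and t: "A \<le> t" "t \<le> B"
  shows "D t = 0"
proof (cases "s \<le> t")
  case True
  have "\<bar>D t\<bar> \<le> 0 * exp ((2 * K + 1) * (B - s))"
    by (rule gronwall_abs[where D = D and D' = D'])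
      (use True s t \<open>K \<ge> 0\<close> der bd in \<open>auto intro: continuous_on_subset[OF c]\<close>)
  then show ?thesis by simp
next
  case False
  have "\<bar>D (- (- t))\<bar> \<le> 0 * exp ((2 * K + 1) * (- A - (- s)))"
  proof (rule gronwall_abs[where D = "\<lambda>x. D (- x)" and D' = "\<lambda>x. - D' (- x)" and t = "- t"])
    show "continuous_on {- s..- A} (\<lambda>x. D (- x))"
      using s by (intro continuous_on_compose2[OF c] continuous_intros) auto
    fix x assume x: "- s < x" "x < - A"
    then have "(D has_real_derivative D' (- x)) (at (- x))" "\<bar>D' (- x)\<bar> \<le> K * \<bar>D (- x)\<bar>"
      using s by (auto intro!: der bd)
    then show "((\<lambda>x. D (- x)) has_real_derivative - D' (- x)) (at x)"
      "\<bar>- D' (- x)\<bar> \<le> 0 + K * \<bar>D (- x)\<bar>"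
      by (auto simp: DERIV_mirror)
  qed (use False s t \<open>K \<ge> 0\<close> in auto)
  then show ?thesis by simp
qed

text \<open>A zero can only be crossed upwards, so D cannot become negative after A. Since the
  hypothesis concerns zeros alone, this yields strict comparison of two solutions from an inequality
  between their slopes at coincidences.\<close>

lemma positive_after_crossing:
  fixes D D' :: "real \<Rightarrow> real"
  assumes der: "\<And>t. A \<le> t \<Longrightarrow> t \<le> B \<Longrightarrow> (D has_real_derivative D' t) (at t within {A..B})"
    and "D A = 0"
    and pos: "\<And>t. A \<le> t \<Longrightarrow> t \<le> B \<Longrightarrow> D t = 0 \<Longrightarrow> D' t > 0"
    and t: "A < t" "t \<le> B"
  shows "D t > 0"
proof (rule ccontr)
  assume "\<not> D t > 0"
  have cont: "continuous_on {A..B} D"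
    using der by (meson DERIV_continuous atLeastAtMost_iff continuous_on_eq_continuous_within)
  \<comment> \<open>If D vanishes at t, its positive slope there makes it negative slightly to the
    left.\<close>
  have "\<exists>t'. A < t' \<and> t' \<le> B \<and> D t' < 0"
  proof (cases "D t = 0")
    case True
    then obtain d where d: "d > 0" "\<And>h. h > 0 \<Longrightarrow> t - h \<in> {A..B} \<Longrightarrow> h < d \<Longrightarrow> D (t - h) < D t"
      using has_real_derivative_pos_inc_left[OF der[of t] pos[of t]] t by force
    define h where "h = min (d / 2) ((t - A) / 2)"
    have "h > 0" "h < d" "t - h > A" "t - h \<le> B"
      using t d(1) by (auto simp: h_def min_def field_simps)
    then show ?thesis using d(2)[of h] True by (intro exI[of _ "t - h"]) auto
  next
    case False
    then show ?thesis using \<open>\<not> D t > 0\<close> t by (intro exI[of _ t]) auto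
  qed
  then obtain t' where t': "A < t'" "t' \<le> B" "D t' < 0" by blast
  \<comment> \<open>The last point s of S is a zero of D with only negative values after it,
    contrary to the positive slope at s.\<close>
  define S where "S = {s \<in> {A..t'}. 0 \<le> D s}"
  have "closed S"
    unfolding S_def using t'
    by (intro continuous_closed_preimage_constant continuous_on_closed_Collect_le continuous_intros
        continuous_on_subset[OF cont]) auto
  then have "compact S"
    by (rule compact_Int_closed[of "{A..t'}" S, OF compact_Icc, THEN back_subst[of compact]])
      (auto simp: S_def)
  moreover have "A \<in> S" using t' \<open>D A = 0\<close> by (auto simp: S_def)
  ultimately obtain s where s: "s \<in> S" "\<And>x. x \<in> S \<Longrightarrow> x \<le> s"
    using compact_attains_sup[of S] by blast
  have sb: "A \<le> s" "s < t'" "D s \<ge> 0"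
    using s(1) t' by (auto simp: S_def order.order_iff_strict)
  have neg: "D x < 0" if "s < x" "x \<le> t'" for x
    using s(2)[of x] that sb by (force simp: S_def)
  have "D s \<le> 0"
  proof (rule ccontr)
    assume "\<not> D s \<le> 0"
    then have "\<exists>x\<ge>s. x \<le> t' \<and> D x = 0"
      using sb t' by (intro IVT2') (auto intro: continuous_on_subset[OF cont])
    then obtain x where "s \<le> x" "x \<le> t'" "D x = 0" by blast
    with neg[of x] \<open>\<not> D s \<le> 0\<close> show False by (cases "s = x") auto
  qed
  then have "D s = 0" using sb by simp
  then obtain d where d: "d > 0" "\<And>h. h > 0 \<Longrightarrow> s + h \<in> {A..B} \<Longrightarrow> h < d \<Longrightarrow> D s < D (s + h)"
    using has_real_derivative_pos_inc_right[OF der[of s] pos[of s]] sb t' by force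
  define h where "h = min (d / 2) (t' - s)"
  have "h > 0" "h < d" "s + h \<le> t'" using sb d(1) by (auto simp: h_def)
  then have "D s < D (s + h)" "D (s + h) < 0"
    using d(2)[of h] neg[of "s + h"] sb t' by auto
  with \<open>D s = 0\<close> show False by simp
qed

text \<open>Integrating C exp (K s) gains a factor 1 / K; this gain is the contraction constant of
  the Picard operator in the weighted norm.\<close>

lemma abs_integral_exp_le:
  fixes h :: "real \<Rightarrow> real"
  assumes "continuous_on {A..t} h" "A \<le> t" "K > 0"
    and bd: "\<And>s. A \<le> s \<Longrightarrow> s \<le> t \<Longrightarrow> \<bar>h s\<bar> \<le> C * exp (K * s)"
  shows "exp (- (K * t)) * \<bar>integral {A..t} h\<bar> \<le> C / K"
proof -
  have I: "((\<lambda>s. C * exp (K * s)) has_integral (C / K * exp (K * t) - C / K * exp (K * A))) {A..t}"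
    by (rule fundamental_theorem_of_calculus[OF assms(2)])
      (use \<open>K > 0\<close> in \<open>auto intro!: derivative_eq_intros simp: has_real_derivative_iff_has_vector_derivative[symmetric]\<close>)
  have "norm (integral {A..t} h) \<le> integral {A..t} (\<lambda>s. C * exp (K * s))"
    by (intro integral_norm_bound_integral integrable_continuous_interval assms(1) continuous_intros)
      (use bd in auto)
  also have "\<dots> = C / K * exp (K * t) - C / K * exp (K * A)"
    using I by (rule integral_unique)
  also have "\<dots> \<le> C / K * exp (K * t)"
  proof -
    have "0 \<le> C * exp (K * A)" using bd[of A] assms(2) by linarith
    then have "0 \<le> C * exp (K * A) / K" using \<open>K > 0\<close> by (rule divide_nonneg_pos)
    then show ?thesis by (subst (asm) times_divide_eq_left[symmetric]) linarith
  qed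
  finally have "exp (- (K * t)) * \<bar>integral {A..t} h\<bar> \<le> exp (- (K * t)) * (C / K * exp (K * t))"
    by (intro mult_left_mono) auto
  also have "\<dots> = C / K" by (simp add: exp_minus)
  finally show ?thesis .
qed

text \<open>In the supremum norm weighted by \<open>exp (- K t)\<close>, with \<open>K > 2 L\<close>, the Picard operator is a
  contraction on the whole interval, so no continuation argument is needed.\<close>

lemma picard_global:
  fixes g :: "real \<Rightarrow> real \<Rightarrow> real"
  assumes "A \<le> B"
    and gc: "\<And>x. continuous_on {A..B} x \<Longrightarrow> continuous_on {A..B} (\<lambda>s. g s (x s))"
    and lip: "\<And>s x y. A \<le> s \<Longrightarrow> s \<le> B \<Longrightarrow> \<bar>g s x - g s y\<bar> \<le> L * \<bar>x - y\<bar>"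
  shows "\<exists>x. x A = x0 \<and> (\<forall>t\<in>{A..B}. (x has_real_derivative g t (x t)) (at t within {A..B}))"
proof -
  define K where "K = 2 * \<bar>L\<bar> + 1"
  have K: "K > 0" "\<bar>L\<bar> / K \<le> 1 / 2" by (auto simp: K_def field_simps)
  \<comment> \<open>A bounded continuous y represents the candidate solution \<open>w y\<close>, so
    the plain supremum distance of the complete function space is the weighted distance of
    candidates.\<close>
  define w where "w = (\<lambda>y :: real \<Rightarrow>\<^sub>C real. \<lambda>s. exp (K * s) * apply_bcontfun y s)"
  \<comment> \<open>Clamping to [A, B] extends functions on the interval to bounded continuous
    functions on the whole line.\<close>
  define cl where "cl = (\<lambda>t. max A (min B t))"
  have cl: "A \<le> cl t" "cl t \<le> B" for t using \<open>A \<le> B\<close> by (auto simp: cl_def)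
  have clid: "cl t = t" if "t \<in> {A..B}" for t using that by (auto simp: cl_def)
  have wc: "continuous_on {A..B} (\<lambda>s. g s (w y s))" for y
    by (intro gc) (auto simp: w_def intro!: continuous_intros)
  define J where "J = (\<lambda>y t. x0 + integral {A..t} (\<lambda>s. g s (w y s)))"
  have Jder: "(J y has_real_derivative g t (w y t)) (at t within {A..B})" if "t \<in> {A..B}" for y t
    unfolding J_def using integral_has_real_derivative[OF wc that] 
    by (auto intro!: derivative_eq_intros)
  have Jc: "continuous_on {A..B} (J y)" for y
    using Jder by (meson DERIV_continuous continuous_on_eq_continuous_within)
  define T0 where "T0 = (\<lambda>y t. exp (- (K * cl t)) * J y (cl t))"
  have clc: "continuous_on UNIV cl" unfolding cl_def by (intro continuous_intros)
  have T0: "T0 y \<in> bcontfun" for y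
  proof -
    have h: "continuous_on {A..B} (\<lambda>t. exp (- (K * t)) * J y t)"
      by (intro continuous_intros Jc)
    have "continuous_on UNIV (T0 y)"
      unfolding T0_def by (rule continuous_on_compose2[OF h clc]) (use cl in auto)
    moreover have "bounded (range (T0 y))"
      by (rule bounded_subset[OF compact_imp_bounded[OF compact_continuous_image[OF h compact_Icc]]])
        (use cl in \<open>auto simp: T0_def\<close>)
    ultimately show ?thesis by (auto simp: bcontfun_def)
  qed
  define T where "T = (\<lambda>y. Bcontfun (T0 y))"
  have T: "apply_bcontfun (T y) = T0 y" for y
    using T0 by (simp add: T_def Bcontfun_inverse)
  have "\<exists>!y. T y = y"
  proof (rule banach_fix_type)
    show "\<forall>y z. dist (T y) (T z) \<le> 1 / 2 * dist y z"
    proof (intro allI dist_bound)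
      fix y z t
      let ?h = "\<lambda>s. g s (w y s) - g s (w z s)"
      let ?t = "cl t"
      have sub: "{A..?t} \<subseteq> {A..B}" using cl by auto
      have "dist (T y t) (T z t) = exp (- (K * ?t)) * \<bar>integral {A..?t} ?h\<bar>"
      proof -
        have "integral {A..?t} ?h = J y ?t - J z ?t"
          unfolding J_def
          by (subst integral_diff)
            (auto intro!: integrable_continuous_interval continuous_on_subset[OF wc sub])
        then show ?thesis
          by (simp add: T T0_def dist_real_def abs_mult right_diff_distrib[symmetric])
      qed
      also have "\<dots> \<le> \<bar>L\<bar> * dist y z / K"
      proof (rule abs_integral_exp_le[OF _ cl(1) K(1)])
        show "continuous_on {A..?t} ?h"
          by (intro continuous_intros continuous_on_subset[OF wc sub])
        fix s assume "A \<le> s" "s \<le> ?t"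
        then have "\<bar>?h s\<bar> \<le> L * \<bar>w y s - w z s\<bar>"
          using lip[of s "w y s" "w z s"] cl[of t] by auto
        also have "\<dots> \<le> \<bar>L\<bar> * (exp (K * s) * dist y z)"
          using dist_bounded[of y s z]
          by (intro mult_mono) (auto simp: w_def dist_real_def abs_mult right_diff_distrib[symmetric])
        finally show "\<bar>?h s\<bar> \<le> \<bar>L\<bar> * dist y z * exp (K * s)" by (simp add: mult_ac)
      qed
      also have "\<dots> \<le> 1 / 2 * dist y z"
        using mult_right_mono[OF K(2), of "dist y z"] by simp
      finally show "dist (T y t) (T z t) \<le> 1 / 2 * dist y z" .
    qed
  qed auto
  then obtain y where y: "T y = y" by blast
  have wJ: "w y t = J y t" if "t \<in> {A..B}" for t
  proof -
    have "apply_bcontfun y t = exp (- (K * t)) * J y t"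
      using T[of y] that by (simp add: y T0_def clid)
    then show ?thesis by (simp add: w_def exp_minus)
  qed
  have "(J y has_real_derivative g t (J y t)) (at t within {A..B})" if "t \<in> {A..B}" for t
    using Jder[OF that, of y] wJ[OF that] by simp
  moreover have "J y A = x0" by (simp add: J_def)
  ultimately show ?thesis by blast
qed

section \<open>The quasi-polar angle and the half period\<close>

definition phi :: "nat \<Rightarrow> real \<Rightarrow> real" where
  "phi r s = \<bar>s\<bar> ^ (r - 1) * s"

lemma phi_minus: "phi r (- s) = - phi r s"
  by (simp add: phi_def)

lemma phi_mult: "phi r (x * y) = phi r x * phi r y"
  by (simp add: phi_def abs_mult power_mult_distrib)

lemma phi_eq_0_iff [simp]: "phi r s = 0 \<longleftrightarrow> s = 0"
  by (auto simp: phi_def)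

lemma phi_0 [simp]: "phi r 0 = 0"
  by simp

lemma phi_nonneg_eq: "r \<ge> 1 \<Longrightarrow> s \<ge> 0 \<Longrightarrow> phi r s = s ^ r"
  unfolding phi_def by (metis One_nat_def Suc_le_D abs_of_nonneg diff_Suc_1 power_Suc2)

lemma phi_mult_self: "r \<ge> 1 \<Longrightarrow> s * phi r s = \<bar>s\<bar> ^ (r + 1)"
  by (cases r) (auto simp: phi_def power2_eq_square[symmetric] mult_ac)

text \<open>\<open>root r\<close> is odd for every r, even or odd, as is \<open>phi r\<close>;
  negative arguments therefore reduce to positive ones, and the two maps are inverse bijections of
  the whole line.\<close>

lemma phi_root [simp]:
  assumes "r \<ge> 1" shows "phi r (root r z) = z"
proof (cases "z \<ge> 0")
  case True
  then show ?thesis using assms by (simp add: phi_nonneg_eq)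
next
  case False
  then have "phi r (root r (- z)) = - z" using assms by (simp add: phi_nonneg_eq)
  then show ?thesis by (simp add: real_root_minus phi_minus)
qed

lemma root_phi [simp]:
  assumes "r \<ge> 1" shows "root r (phi r s) = s"
proof (cases "s \<ge> 0")
  case True
  then show ?thesis using assms by (simp add: phi_nonneg_eq real_root_power_cancel)
next
  case False
  then have "root r (phi r (- s)) = - s" using assms by (simp add: phi_nonneg_eq real_root_power_cancel)
  then show ?thesis by (simp add: real_root_minus phi_minus)
qed

lemma phi_inject: "r \<ge> 1 \<Longrightarrow> phi r x = phi r y \<longleftrightarrow> x = y"
  by (metis root_phi)

lemma continuous_on_phi [continuous_intros]:
  "continuous_on S f \<Longrightarrow> continuous_on S (\<lambda>x. phi r (f x))"
  unfolding phi_def by (intro continuous_intros)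

lemma DERIV_phi:
  assumes "r \<ge> 1"
  shows "(phi r has_real_derivative real r * \<bar>s\<bar> ^ (r - 1)) (at s)"
proof -
  have pos: "(phi r has_real_derivative real r * s ^ (r - 1)) (at s)" if "s > 0" for s
  proof (rule has_field_derivative_transform_within_open[of "\<lambda>s. s ^ r" _ _ "{0<..}"])
    show "((\<lambda>s. s ^ r) has_real_derivative real r * s ^ (r - 1)) (at s)"
      by (auto intro!: derivative_eq_intros)
  qed (use that assms in \<open>auto simp: phi_nonneg_eq\<close>)
  consider "s > 0" | "s < 0" | "s = 0" by linarith
  then show ?thesis
  proof cases
    case 1 then show ?thesis using pos[of s] by simp
  next
    case 2
    then have "((\<lambda>x. - phi r (- x)) has_real_derivative real r * (- s) ^ (r - 1)) (at s)"
      using pos[of "- s"] by (auto intro!: derivative_eq_intros simp: DERIV_mirror)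
    then show ?thesis using 2 by (simp add: phi_minus)
  next
    case 3
    \<comment> \<open>At the origin the difference quotient is |h|^(r-1). It tends to 0 unless r =
      1, where the claimed value is 1 because \<open>0 ^ 0 = 1\<close>.\<close>
    show ?thesis
    proof (cases "r = 1")
      case True
      then show ?thesis by (auto simp: phi_def[abs_def])
    next
      case False
      have "((\<lambda>h. \<bar>h\<bar> ^ (r - 1)) \<longlongrightarrow> \<bar>0\<bar> ^ (r - 1)) (at (0::real))"
        by (intro tendsto_intros)
      then have "((\<lambda>h. \<bar>h\<bar> ^ (r - 1)) \<longlongrightarrow> 0) (at (0::real))"
        using False assms by (simp add: zero_power)
      then have "((\<lambda>h. phi r h / h) \<longlongrightarrow> 0) (at 0)"
        by (rule Lim_transform_eventually)
          (use False assms in \<open>auto simp: phi_def eventually_at intro!: exI[of _ 1]\<close>)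
      then show ?thesis using 3 False assms by (simp add: DERIV_def zero_power)
    qed
  qed
qed

lemma DERIV_abs_power:
  assumes "r \<ge> 1"
  shows "((\<lambda>s. \<bar>s\<bar> ^ (r + 1)) has_real_derivative (real r + 1) * phi r s) (at s)"
proof -
  have "((\<lambda>s. s * phi r s) has_real_derivative (real r + 1) * phi r s) (at s)"
    by (rule derivative_eq_intros DERIV_phi[OF assms] refl)+ (simp add: phi_def algebra_simps)
  then show ?thesis using assms by (simp only: phi_mult_self)
qed

lemma DERIV_root:
  assumes "r \<ge> 1" "z \<noteq> 0"
  shows "(root r has_real_derivative root r z / (real r * z)) (at z)"
proof -
  have pos: "inverse (real r * root r z ^ (r - Suc 0)) = root r z / (real r * z)"
    if "root r z ^ r = z" "z \<noteq> 0" for z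
  proof -
    have "root r z * root r z ^ (r - Suc 0) = z"
      using that assms power_minus_mult[of r "root r z"] by (simp add: mult.commute)
    then show ?thesis using assms that by (simp add: field_simps)
  qed
  have neg: "- inverse (real r * root r z ^ (r - Suc 0)) = root r z / (real r * z)"
    if "even r" "z < 0"
  proof -
    have "root r (- z) ^ r = - z" using that assms by simp
    then have "inverse (real r * root r (- z) ^ (r - Suc 0)) = root r (- z) / (real r * (- z))"
      using that by (intro pos) auto
    then show ?thesis using that assms by (simp add: real_root_minus)
  qed
  show ?thesis
    by (rule DERIV_real_root_generic)
      (use assms neg pos[of z] in \<open>auto simp: odd_real_root_pow\<close>)
qed

lemma mult_root_self:
  assumes "r \<ge> 1" shows "z * root r z = \<bar>root r z\<bar> ^ (r + 1)"
  using phi_mult_self[OF assms, of "root r z"] phi_root[OF assms, of z] by (simp add: mult.commute)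

text \<open>Although \<open>root r\<close> has no derivative at 0 for r > 1, the product z * root r
  z = |z|^(1+1/r) is continuously differentiable: its difference quotient at 0 is root r h. This
  regularity makes both the angle equation and one Riccati equation Lipschitz on bounded
  sets.\<close>

lemma DERIV_mult_root:
  assumes "r \<ge> 1"
  shows "((\<lambda>z. z * root r z) has_real_derivative (1 + 1 / real r) * root r z) (at z)"
proof (cases "z = 0")
  case False
  show ?thesis
    by (rule derivative_eq_intros DERIV_root[OF assms False] refl)+
      (use assms False in \<open>simp add: field_simps\<close>)
next
  case True
  have "isCont (root r) 0" using assms by (intro isCont_real_root) 
  then have "(root r \<longlongrightarrow> 0) (at 0)" using assms by (simp add: isCont_def)
  then have "((\<lambda>h. h * root r h / h) \<longlongrightarrow> 0) (at 0)"
    by (rule Lim_transform_eventually) (auto simp: eventually_at intro!: exI[of _ 1])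
  then show ?thesis using True assms by (simp add: DERIV_def)
qed

section \<open>Power-type cosine and sine, and the Lipschitz angle equation\<close>

definition pcos :: "nat \<Rightarrow> real \<Rightarrow> real" where "pcos r x = cos x * root r (cos x)"
definition psin :: "nat \<Rightarrow> real \<Rightarrow> real" where "psin r x = \<bar>sin x\<bar> ^ (r + 1)"
text \<open>The determinant of the linear system that the substitution gives for the unknowns P' / P
  and \<beta>'.\<close>

definition pden :: "nat \<Rightarrow> real \<Rightarrow> real" where "pden r x = real r * (cos x)\<^sup>2 + (sin x)\<^sup>2"

text \<open>The right-hand side of the quasi-polar angle equation: for
  \<open>v = P sin \<beta>\<close>, \<open>z = (m P) ^ r cos \<beta>\<close>, the system \<open>v' = a * root r z\<close>,
  \<open>z' = - r m ^ (r + 1) b phi r v\<close> yields \<open>\<beta>' = m * r * pang r a b \<beta>\<close>.\<close>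

definition pang :: "nat \<Rightarrow> real \<Rightarrow> real \<Rightarrow> real \<Rightarrow> real" where
  "pang r a b x = (a * pcos r x + b * psin r x) / pden r x"

text \<open>In other words |cos x|^(1+1/r), whose exponent p / (p - 1) is conjugate to the exponent
  p = r + 1 of \<open>psin\<close>.\<close>

lemma pcos_eq: "r \<ge> 1 \<Longrightarrow> pcos r x = \<bar>root r (cos x)\<bar> ^ (r + 1)"
  by (simp only: pcos_def mult_root_self)

lemma pcos_nonneg: "r \<ge> 1 \<Longrightarrow> pcos r x \<ge> 0"
  by (simp only: pcos_eq) simp

lemma psin_nonneg: "psin r x \<ge> 0"
  by (simp add: psin_def)

lemma abs_root_le_1: "r \<ge> 1 \<Longrightarrow> \<bar>z\<bar> \<le> 1 \<Longrightarrow> \<bar>root r z\<bar> \<le> 1"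
  by (simp add: real_root_abs[symmetric])

lemma pcos_le_1: "r \<ge> 1 \<Longrightarrow> pcos r x \<le> 1"
  by (simp only: pcos_eq) (intro power_le_one abs_root_le_1, auto)

lemma psin_le_1: "psin r x \<le> 1"
  unfolding psin_def by (intro power_le_one) auto

lemma pcos_psin_pos: "r \<ge> 1 \<Longrightarrow> a > 0 \<Longrightarrow> b > 0 \<Longrightarrow> a * pcos r x + b * psin r x > 0"
proof -
  assume r: "r \<ge> 1" and ab: "a > 0" "b > 0"
  show ?thesis
  proof (cases "sin x = 0")
    case True
    then have "cos x \<noteq> 0" using sin_cos_squared_add[of x] by auto
    then have "pcos r x > 0" using r pcos_nonneg[OF r, of x] by (auto simp: pcos_def less_le)
    then show ?thesis using ab psin_nonneg[of r x] by (simp add: add_pos_nonneg)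
  next
    case False
    then have "psin r x > 0" by (simp add: psin_def)
    then show ?thesis using ab pcos_nonneg[OF r, of x] by (simp add: add_nonneg_pos)
  qed
qed

lemma pden_ge_1: "r \<ge> 1 \<Longrightarrow> pden r x \<ge> 1"
proof -
  assume "r \<ge> 1"
  then have "1 * (cos x)\<^sup>2 \<le> real r * (cos x)\<^sup>2" by (intro mult_right_mono) auto
  then show ?thesis unfolding pden_def using sin_cos_squared_add[of x] by linarith
qed

lemma pden_le: "r \<ge> 1 \<Longrightarrow> pden r x \<le> r"
proof -
  assume "r \<ge> 1"
  then have "1 * (sin x)\<^sup>2 \<le> real r * (sin x)\<^sup>2" by (intro mult_right_mono) auto
  then have "pden r x \<le> real r * ((sin x)\<^sup>2 + (cos x)\<^sup>2)"
    unfolding pden_def distrib_left by linarith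
  then show ?thesis by (simp only: sin_cos_squared_add mult_1_right)
qed

lemma pang_pos: "r \<ge> 1 \<Longrightarrow> a > 0 \<Longrightarrow> b > 0 \<Longrightarrow> pang r a b x > 0"
  unfolding pang_def using pcos_psin_pos pden_ge_1[of r x] by (intro divide_pos_pos) auto

lemma DERIV_pcos:
  "r \<ge> 1 \<Longrightarrow> (pcos r has_real_derivative - (1 + 1 / real r) * root r (cos x) * sin x) (at x)"
  unfolding pcos_def
  by (rule DERIV_chain2[OF DERIV_mult_root DERIV_cos, THEN DERIV_cong]) (auto simp: algebra_simps)

lemma DERIV_psin:
  "r \<ge> 1 \<Longrightarrow> (psin r has_real_derivative (real r + 1) * phi r (sin x) * cos x) (at x)"
  unfolding psin_def
  by (rule DERIV_chain2[OF DERIV_abs_power DERIV_sin, THEN DERIV_cong]) auto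

lemma DERIV_pden:
  "(pden r has_real_derivative 2 * (1 - real r) * sin x * cos x) (at x)"
  unfolding pden_def by (auto intro!: derivative_eq_intros simp: algebra_simps)

lemma lipschitz_quotient:
  fixes f d :: "real \<Rightarrow> real"
  assumes f: "\<And>x. (f has_real_derivative f' x) (at x)" and d: "\<And>x. (d has_real_derivative d' x) (at x)"
    and b: "\<And>x. \<bar>f x\<bar> \<le> 1" "\<And>x. \<bar>f' x\<bar> \<le> M" "\<And>x. 1 \<le> d x" "\<And>x. d x \<le> R" "\<And>x. \<bar>d' x\<bar> \<le> K"
  shows "\<bar>f x / d x - f y / d y\<bar> \<le> (M * R + K) * \<bar>x - y\<bar>"
proof -
  have "norm (f x / d x - f y / d y) \<le> (M * R + K) * norm (x - y)"
  proof (rule field_differentiable_bound[of UNIV "\<lambda>x. f x / d x" "\<lambda>x. (f' x * d x - f x * d' x) / (d x * d x)"])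
    fix z :: real
    have dz: "d z \<noteq> 0" using b(3)[of z] by auto
    show "((\<lambda>x. f x / d x) has_real_derivative (f' z * d z - f z * d' z) / (d z * d z)) (at z within UNIV)"
      by (rule DERIV_divide[OF f d dz])
    have "\<bar>f' z * d z - f z * d' z\<bar> \<le> \<bar>f' z\<bar> * \<bar>d z\<bar> + \<bar>f z\<bar> * \<bar>d' z\<bar>"
      by (metis abs_mult abs_triangle_ineq4)
    also have "\<dots> \<le> M * R + 1 * K"
      by (intro add_mono mult_mono) (use b[of z] abs_ge_zero[of "f' z"] in auto)
    finally have "\<bar>f' z * d z - f z * d' z\<bar> \<le> M * R + K" by simp
    moreover have "1 * 1 \<le> d z * d z" using b(3)[of z] by (intro mult_mono) auto
    ultimately have "\<bar>f' z * d z - f z * d' z\<bar> / (d z * d z) \<le> (M * R + K) / 1"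
      by (intro frac_le) auto
    then show "norm ((f' z * d z - f z * d' z) / (d z * d z)) \<le> M * R + K"
      by (simp add: abs_mult)
  qed auto
  then show ?thesis by simp
qed

lemma pang_lipschitz:
  assumes r: "r \<ge> 1" and "\<bar>a\<bar> \<le> M" "\<bar>b\<bar> \<le> M"
  shows "\<bar>pang r a b x - pang r a b y\<bar> \<le> M * (2 * (real r + 3) * real r) * \<bar>x - y\<bar>"
proof -
  have K: "\<bar>2 * (1 - real r) * sin x * cos x\<bar> \<le> 2 * real r" for x
  proof -
    have "\<bar>sin x\<bar> * \<bar>cos x\<bar> \<le> 1 * 1" by (intro mult_mono) auto
    then have "(2 * \<bar>1 - real r\<bar>) * (\<bar>sin x\<bar> * \<bar>cos x\<bar>) \<le> (2 * real r) * 1"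
      using r by (intro mult_mono) auto
    moreover have "\<bar>2 * (1 - real r) * sin x * cos x\<bar> = (2 * \<bar>1 - real r\<bar>) * (\<bar>sin x\<bar> * \<bar>cos x\<bar>)"
      by (simp only: abs_mult mult.assoc abs_numeral)
    ultimately show ?thesis by simp
  qed
  have c': "\<bar>- (1 + 1 / real r) * root r (cos x) * sin x\<bar> \<le> real r + 1" for x
  proof -
    have "\<bar>root r (cos x)\<bar> * \<bar>sin x\<bar> \<le> 1 * 1" by (intro mult_mono abs_root_le_1 r) auto
    moreover have "1 / real r \<le> 1" using r by simp
    then have "1 / real r \<le> real r" using r by linarith
    ultimately have "(1 + 1 / real r) * (\<bar>root r (cos x)\<bar> * \<bar>sin x\<bar>) \<le> (real r + 1) * 1"
      by (intro mult_mono) auto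
    moreover have "\<bar>- (1 + 1 / real r) * root r (cos x) * sin x\<bar>
        = (1 + 1 / real r) * (\<bar>root r (cos x)\<bar> * \<bar>sin x\<bar>)"
      by (simp only: abs_mult abs_minus_cancel mult.assoc) (simp add: abs_of_nonneg)
    ultimately show ?thesis by simp
  qed
  have s': "\<bar>(real r + 1) * phi r (sin x) * cos x\<bar> \<le> real r + 1" for x
  proof -
    have "\<bar>phi r (sin x)\<bar> * \<bar>cos x\<bar> \<le> (1 * 1) * 1"
      unfolding phi_def abs_mult power_abs abs_idempotent
      by (intro mult_mono) (auto simp: power_le_one)
    then have "(real r + 1) * (\<bar>phi r (sin x)\<bar> * \<bar>cos x\<bar>) \<le> (real r + 1) * 1"
      by (intro mult_left_mono) auto
    moreover have "\<bar>(real r + 1) * phi r (sin x) * cos x\<bar> = (real r + 1) * (\<bar>phi r (sin x)\<bar> * \<bar>cos x\<bar>)"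
      by (simp only: abs_mult mult.assoc)
    ultimately show ?thesis by simp
  qed
  \<comment> \<open>With numerator derivative at most r + 1, denominator between 1 and r, and
    denominator derivative at most 2 r, each quotient has Lipschitz constant r (r + 3). The two
    quotients, weighted by a and b, account for the factor 2 M.\<close>
  let ?L = "(real r + 1) * real r + 2 * real r"
  have C: "\<bar>pcos r x / pden r x - pcos r y / pden r y\<bar> \<le> ?L * \<bar>x - y\<bar>"
    by (rule lipschitz_quotient[OF DERIV_pcos[OF r] DERIV_pden])
      (use r pcos_nonneg pcos_le_1 pden_ge_1 pden_le c' K in \<open>auto simp: abs_of_nonneg\<close>)
  have S: "\<bar>psin r x / pden r x - psin r y / pden r y\<bar> \<le> ?L * \<bar>x - y\<bar>"
    by (rule lipschitz_quotient[OF DERIV_psin[OF r] DERIV_pden])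
      (use r psin_nonneg psin_le_1 pden_ge_1 pden_le s' K in \<open>auto simp: abs_of_nonneg\<close>)
  have "pang r a b x - pang r a b y = a * (pcos r x / pden r x - pcos r y / pden r y)
      + b * (psin r x / pden r x - psin r y / pden r y)"
    by (simp add: pang_def add_divide_distrib algebra_simps)
  then have "\<bar>pang r a b x - pang r a b y\<bar> \<le> \<bar>a\<bar> * \<bar>pcos r x / pden r x - pcos r y / pden r y\<bar>
      + \<bar>b\<bar> * \<bar>psin r x / pden r x - psin r y / pden r y\<bar>"
    by (metis abs_mult abs_triangle_ineq)
  also have "\<dots> \<le> M * (?L * \<bar>x - y\<bar>) + M * (?L * \<bar>x - y\<bar>)"
    by (intro add_mono mult_mono[OF assms(2) C] mult_mono[OF assms(3) S] abs_ge_zero)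
      (use assms(2) abs_ge_zero[of a] in linarith)+
  also have "\<dots> = M * (2 * (real r + 3) * real r) * \<bar>x - y\<bar>"
  proof -
    have "M * (?L * d) + M * (?L * d) = M * (2 * (real r + 3) * real r) * d" for d
      by (simp add: algebra_simps)
    then show ?thesis .
  qed
  finally show ?thesis .
qed

lemma continuous_on_pang:
  fixes a b x :: "real \<Rightarrow> real"
  assumes r: "r \<ge> 1" and "continuous_on S a" "continuous_on S b" "continuous_on S x"
  shows "continuous_on S (\<lambda>t. pang r (a t) (b t) (x t))"
proof -
  have "real r * (cos (x t))\<^sup>2 + (sin (x t))\<^sup>2 \<noteq> 0" for t
    using pden_ge_1[OF r, of "x t"] by (simp add: pden_def)
  then show ?thesis
    unfolding pang_def pcos_def psin_def
    unfolding pden_def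
    by (intro continuous_intros assms ballI) auto
qed

lemma pcos_add_pi: "pcos r (x + pi) = pcos r x" "pcos r (pi - x) = pcos r x"
  by (simp_all add: pcos_def real_root_minus)

lemma psin_add_pi: "psin r (x + pi) = psin r x" "psin r (pi - x) = psin r x"
  by (simp_all add: psin_def)

lemma pden_add_pi: "pden r (x + pi) = pden r x" "pden r (pi - x) = pden r x"
  by (simp_all add: pden_def)

section \<open>The half period as a Beta integral\<close>

lemma Gamma_reflection_real:
  assumes "0 < x" "x < 1"
  shows "Gamma x * Gamma (1 - x) = pi / sin (pi * x :: real)"
proof -
  have "Gamma (complex_of_real x) * Gamma (complex_of_real (1 - x))
      = complex_of_real pi / sin (complex_of_real (pi * x))"
    using Gamma_reflection_complex[of "of_real x"] by (simp only: of_real_diff of_real_1 of_real_mult)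
  then have "complex_of_real (Gamma x * Gamma (1 - x)) = of_real (pi / sin (pi * x))"
    by (simp only: sin_of_real Gamma_complex_of_real flip: of_real_mult of_real_divide)
  then show ?thesis by (simp only: of_real_eq_iff)
qed

text \<open>The reciprocal of the angular velocity \<open>m * r * pang r a b x\<close> at m = a = b
  = 1, so a primitive of it advances at unit speed along the constant-coefficient solution.\<close>

definition pgen :: "nat \<Rightarrow> real \<Rightarrow> real" where
  "pgen r x = pden r x / (real r * (pcos r x + psin r x))"

lemma pgen_nonzero:
  assumes "r \<ge> 1" shows "real r * (pcos r x + psin r x) > 0"
  using pcos_psin_pos[OF assms, of 1 1 x] assms by simp

text \<open>The substitution t = \<open>psin / (pcos + psin)\<close> maps [0, pi/2] onto [0, 1] and
  turns p times \<open>pgen\<close> into the Beta integrand t^(1/p-1) (1-t)^(-1/p). That integrand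
  is singular at both ends, so derivatives are compared only inside and the endpoints are reached by
  continuity.\<close>

lemma beta_substitution:
  assumes r: "r \<ge> 1" and G: "\<And>x. (G has_real_derivative pgen r x) (at x)" and "G 0 = 0"
  shows "(real r + 1) * G (pi / 2) = Beta (1 / (real r + 1)) (1 - 1 / (real r + 1))"
proof -
  define p where "p = real r + 1"
  have p: "p > 1" using r by (simp add: p_def)
  define f where "f = (\<lambda>t. t powr (1 / p - 1) * (1 - t) powr (1 - 1 / p - 1))"
  have I: "(f has_integral Beta (1 / p) (1 - 1 / p)) {0..1}"
    unfolding f_def using p by (intro has_integral_Beta_real) auto
  then have fi: "f integrable_on {0..1}" by blast
  define H where "H = (\<lambda>x. integral {0..x} f)"
  have Hc: "continuous_on {0..1} H"
    unfolding H_def by (rule indefinite_integral_continuous_1[OF fi])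
  have Hd: "(H has_real_derivative f x) (at x)" if "0 < x" "x < 1" for x
  proof -
    have "isCont f x" unfolding f_def using that by (intro continuous_intros) auto
    then have "(H has_vector_derivative f x) (at x within {0..1})"
      unfolding H_def using that
      by (intro integral_has_vector_derivative_continuous_at[where S = "{}", simplified] fi)
        (auto intro: continuous_at_imp_continuous_at_within)
    then show ?thesis
      using that by (simp add: at_within_Icc_at has_real_derivative_iff_has_vector_derivative)
  qed
  define X where "X = (\<lambda>x. psin r x / (pcos r x + psin r x))"
  have D: "pcos r x + psin r x > 0" for x using pcos_psin_pos[OF r, of 1 1 x] by simp
  define X' where "X' = (\<lambda>x. (1 + 1 / real r) * phi r (sin x) * root r (cos x) * pden r x / (pcos r x + psin r x)^2)"
  have Xd: "(X has_real_derivative X' x) (at x)" for x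
  proof -
    have "(X has_real_derivative ((real r + 1) * phi r (sin x) * cos x * (pcos r x + psin r x)
        - psin r x * (- (1 + 1 / real r) * root r (cos x) * sin x + (real r + 1) * phi r (sin x) * cos x))
         / ((pcos r x + psin r x) * (pcos r x + psin r x))) (at x)"
      unfolding X_def
      by (intro DERIV_divide DERIV_add DERIV_psin DERIV_pcos r) (use D[of x] in auto)
    \<comment> \<open>The terms quadratic in \<open>phi r (sin x)\<close> cancel, and (r+1) cos^2 +
      (1+1/r) sin^2 = (1+1/r) (r cos^2 + sin^2) produces the factor \<open>pden\<close>.\<close>
    moreover have "(real r + 1) * phi r (sin x) * cos x * (pcos r x + psin r x)
        - psin r x * (- (1 + 1 / real r) * root r (cos x) * sin x + (real r + 1) * phi r (sin x) * cos x)
        = (1 + 1 / real r) * phi r (sin x) * root r (cos x) * pden r x"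
    proof -
      have "psin r x = sin x * phi r (sin x)" using phi_mult_self[OF r] by (simp add: psin_def)
      then show ?thesis using r
        by (simp add: pcos_def pden_def field_simps power2_eq_square)
    qed
    ultimately show ?thesis by (simp add: X'_def power2_eq_square)
  qed
  have der: "((\<lambda>x. H (X x) - p * G x) has_real_derivative 0) (at x)" if x: "0 < x" "x < pi / 2" for x
  proof -
    have sc: "sin x > 0" "cos x > 0" using x by (auto intro: sin_gt_zero cos_gt_zero)
    define s where "s = sin x"
    define y where "y = root r (cos x)"
    define E where "E = s ^ (r + 1) + y ^ (r + 1)"
    have pos: "s > 0" "y > 0" using sc r by (auto simp: s_def y_def)
    then have "E > 0" by (simp add: E_def add_pos_pos)
    have ps: "psin r x = s ^ (r + 1)" "pcos r x = y ^ (r + 1)"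
      using pos pcos_eq[OF r, of x] by (auto simp: psin_def s_def y_def)
    have E: "pcos r x + psin r x = E" by (simp add: ps E_def)
    have Xx: "X x = s ^ (r + 1) / E" "1 - X x = y ^ (r + 1) / E"
      using \<open>E > 0\<close> by (auto simp: X_def ps E_def field_simps)
    have "0 < s ^ (r + 1) / E" "0 < y ^ (r + 1) / E"
      using pos \<open>E > 0\<close> by (intro divide_pos_pos zero_less_power; simp)+
    then have X01: "0 < X x" "X x < 1" using Xx by linarith+
    have pw: "(u ^ (r + 1) / E) powr (1 / p) = u / E powr (1 / p)" if "u > 0" for u
    proof -
      have "(u ^ (r + 1)) powr (1 / p) = u"
        using that p by (simp only: powr_realpow[symmetric] powr_powr) (simp add: p_def add.commute)
      then show ?thesis using that \<open>E > 0\<close> by (simp add: powr_divide)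
    qed
    have "f (X x) = (X x powr (1 / p) / X x) * (1 / (1 - X x) powr (1 / p))"
      using X01 by (simp add: f_def powr_diff powr_minus_divide)
    also have "\<dots> = ((s / E powr (1 / p)) / (s ^ (r + 1) / E)) * (1 / (y / E powr (1 / p)))"
      by (simp only: Xx(2)) (simp only: Xx(1) pw[OF pos(1)] pw[OF pos(2)])
    also have "\<dots> = E / (s ^ r * y)"
      using pos \<open>E > 0\<close> by (simp add: field_simps)
    finally have "f (X x) * X' x = E / (s ^ r * y) * ((1 + 1 / real r) * s ^ r * y * pden r x / E ^ 2)"
      using pos r by (simp add: X'_def E phi_nonneg_eq s_def[symmetric] y_def[symmetric])
    also have "\<dots> = p * pgen r x"
      using pos \<open>E > 0\<close> r by (simp add: pgen_def E p_def field_simps power2_eq_square)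
    finally have e: "f (X x) * X' x - p * pgen r x = 0" by simp
    have "((\<lambda>x. H (X x) - p * G x) has_real_derivative f (X x) * X' x - p * pgen r x) (at x)"
      by (intro DERIV_diff DERIV_cmult G DERIV_chain2[OF Hd Xd] X01)
    then show ?thesis by (simp only: e)
  qed
  have "continuous_on {0..pi / 2} (\<lambda>x. H (X x) - p * G x)"
  proof (intro continuous_on_diff continuous_on_mult continuous_on_const)
    show "continuous_on {0..pi / 2} G"
      using G by (meson DERIV_isCont continuous_at_imp_continuous_on)
    have "continuous_on {0..pi / 2} X"
      using Xd by (meson DERIV_isCont continuous_at_imp_continuous_on)
    then show "continuous_on {0..pi / 2} (\<lambda>x. H (X x))"
      by (rule continuous_on_compose2[OF Hc])
        (use D psin_nonneg pcos_nonneg[OF r] in \<open>auto simp: X_def divide_le_eq less_imp_le\<close>)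
  qed
  then have "H (X (pi / 2)) - p * G (pi / 2) = H (X 0) - p * G 0"
    using der by (intro DERIV_isconst_end) auto
  moreover have "X 0 = 0" "X (pi / 2) = 1" using r by (auto simp: X_def psin_def pcos_def)
  ultimately have "p * G (pi / 2) = H 1" using \<open>G 0 = 0\<close> by (simp add: H_def)
  also have "\<dots> = Beta (1 / p) (1 - 1 / p)" unfolding H_def using I by (rule integral_unique)
  finally show ?thesis by (simp only: p_def)
qed

text \<open>\<open>G\<close> turns the quasi-polar angle into the arc length of the generalised sine;
  it maps \<open>pi\<close> to the half period \<open>pi_p p / (p - 1) powr (1 / p)\<close>.\<close>

lemma pruefer_length:
  assumes r: "r \<ge> 1"
  obtains G where "\<And>x. (G has_real_derivative pgen r x) (at x)" "G 0 = 0"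
    "\<And>k. G (real k * pi) = real k * (2 * pi / ((real r + 1) * sin (pi / (real r + 1))))"
proof -
  have "isCont (pgen r) x" for x
    unfolding pgen_def
    by (intro continuous_divide isCont_mult isCont_add continuous_const DERIV_isCont[OF DERIV_pden]
        DERIV_isCont[OF DERIV_pcos[OF r]] DERIV_isCont[OF DERIV_psin[OF r]])
      (use pgen_nonzero[OF r, of x] r in auto)
  then obtain F where F: "\<And>x. (F has_vector_derivative pgen r x) (at x)"
    using einterval_antiderivative[of "-\<infinity>" "\<infinity>" "pgen r"] by auto
  define G where "G = (\<lambda>x. F x - F 0)"
  have G: "(G has_real_derivative pgen r x) (at x)" for x
    unfolding G_def using F[of x]
    by (auto intro!: derivative_eq_intros simp: has_real_derivative_iff_has_vector_derivative)
  have G0: "G 0 = 0" by (simp add: G_def)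
  \<comment> \<open>The symmetry of \<open>pgen\<close> about pi/2 gives G pi = 2 G (pi/2); its
    period pi, used next, gives additivity along multiples of pi.\<close>
  have "((\<lambda>x. G (pi - x) + G x) has_real_derivative 0) (at x)" for x
  proof -
    have "((\<lambda>x. G (pi - x) + G x) has_real_derivative pgen r (pi - x) * (0 - 1) + pgen r x) (at x)"
      by (intro DERIV_add DERIV_chain2[OF G] DERIV_diff DERIV_const DERIV_ident G)
    then show ?thesis by (simp add: pgen_def pcos_add_pi psin_add_pi pden_add_pi)
  qed
  then have "G (pi - pi / 2) + G (pi / 2) = G (pi - 0) + G 0"
    by (intro DERIV_isconst_all[rule_format, of "\<lambda>x. G (pi - x) + G x" "pi / 2" 0]) auto
  then have Gpi: "G pi = 2 * G (pi / 2)" using G0 by simp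
  have "((\<lambda>x. G (x + pi) - G x) has_real_derivative 0) (at x)" for x
  proof -
    have "((\<lambda>x. G (x + pi) - G x) has_real_derivative pgen r (x + pi) * (1 + 0) - pgen r x) (at x)"
      by (intro DERIV_diff DERIV_chain2[OF G] DERIV_add DERIV_const DERIV_ident G)
    then show ?thesis by (simp add: pgen_def pcos_add_pi psin_add_pi pden_add_pi)
  qed
  then have "G (x + pi) - G x = G (0 + pi) - G 0" for x
    by (intro DERIV_isconst_all[rule_format, of "\<lambda>x. G (x + pi) - G x" x 0]) auto
  then have step: "G (x + pi) = G x + G pi" for x using G0 by (simp add: diff_eq_eq add.commute[of "G x"])
  have "G (real k * pi) = real k * G pi" for k
  proof (induction k)
    case (Suc k)
    then show ?case using step[of "real k * pi"] by (simp add: ring_distribs ac_simps)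
  qed (simp add: G0)
  moreover have "G pi = 2 * pi / ((real r + 1) * sin (pi / (real r + 1)))"
  proof -
    have "(real r + 1) * G (pi / 2) = Beta (1 / (real r + 1)) (1 - 1 / (real r + 1))"
      by (rule beta_substitution[OF r G G0])
    also have "\<dots> = pi / sin (pi * (1 / (real r + 1)))"
      unfolding Beta_def using r by (subst Gamma_reflection_real) auto
    finally have e: "(real r + 1) * G (pi / 2) = pi / sin (pi * (1 / (real r + 1)))" .
    have "G (pi / 2) = pi / sin (pi * (1 / (real r + 1))) / (real r + 1)"
      unfolding e[symmetric] by (rule nonzero_mult_div_cancel_left[symmetric]) simp
    then show ?thesis unfolding Gpi by (simp add: mult.commute)
  qed
  ultimately show ?thesis using that[OF G G0] by metis
qed

section \<open>Eigenvalues of the first-order system\<close>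

lemma lipschitz_on_bounded:
  fixes k :: "real \<Rightarrow> real"
  assumes k: "\<And>x. (k has_real_derivative k' x) (at x)" and k': "continuous_on UNIV k'"
  obtains L where "L \<ge> 0" "\<And>x y. \<bar>x\<bar> \<le> M \<Longrightarrow> \<bar>y\<bar> \<le> M \<Longrightarrow> \<bar>k x - k y\<bar> \<le> L * \<bar>x - y\<bar>"
proof -
  have "compact (k' ` {-M..M})"
    by (intro compact_continuous_image continuous_on_subset[OF k']) auto
  then obtain L where L: "\<And>x. x \<in> {-M..M} \<Longrightarrow> \<bar>k' x\<bar> \<le> L"
    by (metis bounded_iff compact_imp_bounded imageI real_norm_def)
  have "norm (k x - k y) \<le> max 0 L * norm (x - y)" if "\<bar>x\<bar> \<le> M" "\<bar>y\<bar> \<le> M" for x y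
    by (rule field_differentiable_bound[of "{-M..M}"])
      (use that L in \<open>auto intro: has_field_derivative_at_within[OF k] max.coboundedI2\<close>)
  then show ?thesis using that[of "max 0 L"] by simp
qed

text \<open>The shape al + ga * k y fits both Riccati equations. The two solutions are bounded on
  the compact interval, so k is Lipschitz on their range and their difference obeys |D'| \<le> C L
  |D|. Agreement at s then spreads in both directions.\<close>

lemma scalar_ode_unique:
  fixes y1 y2 k :: "real \<Rightarrow> real"
  assumes c: "continuous_on {A..B} y1" "continuous_on {A..B} y2"
    and d1: "\<And>t. A < t \<Longrightarrow> t < B \<Longrightarrow> (y1 has_real_derivative al t + ga t * k (y1 t)) (at t)"
    and d2: "\<And>t. A < t \<Longrightarrow> t < B \<Longrightarrow> (y2 has_real_derivative al t + ga t * k (y2 t)) (at t)"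
    and ga: "\<And>t. A < t \<Longrightarrow> t < B \<Longrightarrow> \<bar>ga t\<bar> \<le> C"
    and k: "\<And>x. (k has_real_derivative k' x) (at x)" "continuous_on UNIV k'"
    and s: "s \<in> {A..B}" "y1 s = y2 s" and t: "t \<in> {A..B}"
  shows "y1 t = y2 t"
proof -
  have "bounded (y1 ` {A..B} \<union> y2 ` {A..B})"
    by (intro bounded_Un[THEN iffD2] conjI compact_imp_bounded compact_continuous_image c compact_Icc)
  then obtain M where "\<And>x. x \<in> y1 ` {A..B} \<union> y2 ` {A..B} \<Longrightarrow> \<bar>x\<bar> \<le> M"
    by (metis bounded_iff real_norm_def)
  then have M: "\<bar>y1 t\<bar> \<le> M \<and> \<bar>y2 t\<bar> \<le> M" if "t \<in> {A..B}" for t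
    using that by blast
  obtain L where L: "L \<ge> 0" "\<And>x y. \<bar>x\<bar> \<le> M \<Longrightarrow> \<bar>y\<bar> \<le> M \<Longrightarrow> \<bar>k x - k y\<bar> \<le> L * \<bar>x - y\<bar>"
    using lipschitz_on_bounded[OF k] by metis
  have "y1 t - y2 t = 0"
  proof (rule zero_propagates[where D = "\<lambda>t. y1 t - y2 t" and s = s and K = "\<bar>C\<bar> * L"])
    show "continuous_on {A..B} (\<lambda>t. y1 t - y2 t)" by (intro continuous_intros c)
    fix t assume t: "A < t" "t < B"
    show "((\<lambda>t. y1 t - y2 t) has_real_derivative ga t * (k (y1 t) - k (y2 t))) (at t)"
      by (rule DERIV_diff[OF d1[OF t] d2[OF t], THEN DERIV_cong]) (simp add: algebra_simps)
    have "\<bar>ga t\<bar> * \<bar>k (y1 t) - k (y2 t)\<bar> \<le> \<bar>C\<bar> * (L * \<bar>y1 t - y2 t\<bar>)"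
      by (intro mult_mono L(2)) (use ga[OF t] M[of t] t in auto)
    then show "\<bar>ga t * (k (y1 t) - k (y2 t))\<bar> \<le> \<bar>C\<bar> * L * \<bar>y1 t - y2 t\<bar>"
      by (simp add: abs_mult mult.assoc)
  qed (use s t L(1) in auto)
  then show ?thesis by simp
qed

locale half_linear =
  fixes r :: nat and A B :: real and a b :: "real \<Rightarrow> real"
  assumes r: "r \<ge> 1" and AB: "A < B"
    and ac: "continuous_on {A..B} a" and bc: "continuous_on {A..B} b"
    and ap: "\<And>t. t \<in> {A..B} \<Longrightarrow> a t > 0" and bp: "\<And>t. t \<in> {A..B} \<Longrightarrow> b t > 0"
begin

text \<open>Derivatives are demanded only in the open interval and continuity up to the ends, as for
  classical solutions of the differential equation in the annulus.\<close>

definition sol :: "real \<Rightarrow> (real \<Rightarrow> real) \<Rightarrow> (real \<Rightarrow> real) \<Rightarrow> bool" where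
  "sol lam v z \<longleftrightarrow> continuous_on {A..B} v \<and> continuous_on {A..B} z \<and>
     (\<forall>t\<in>{A<..<B}. (v has_real_derivative a t * root r (z t)) (at t) \<and>
        (z has_real_derivative - lam * b t * phi r (v t)) (at t))"

definition eig :: "real \<Rightarrow> bool" where
  "eig lam \<longleftrightarrow> (\<exists>v z. sol lam v z \<and> v A = 0 \<and> v B = 0 \<and> (\<exists>t\<in>{A<..<B}. v t \<noteq> 0))"

lemma solD:
  assumes "sol lam v z"
  shows "continuous_on {A..B} v" "continuous_on {A..B} z"
    "\<And>t. A < t \<Longrightarrow> t < B \<Longrightarrow> (v has_real_derivative a t * root r (z t)) (at t)"
    "\<And>t. A < t \<Longrightarrow> t < B \<Longrightarrow> (z has_real_derivative - lam * b t * phi r (v t)) (at t)"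
  using assms by (auto simp: sol_def)

lemma coeff_bound:
  obtains M where "M > 0" "\<And>t. t \<in> {A..B} \<Longrightarrow> a t \<le> M \<and> b t \<le> M"
proof -
  have "bounded (a ` {A..B} \<union> b ` {A..B})"
    by (intro bounded_Un[THEN iffD2] conjI compact_imp_bounded compact_continuous_image ac bc compact_Icc)
  then obtain M where M: "\<And>x. x \<in> a ` {A..B} \<union> b ` {A..B} \<Longrightarrow> \<bar>x\<bar> \<le> M"
    by (metis bounded_iff real_norm_def)
  have "a t \<le> M \<and> b t \<le> M" if "t \<in> {A..B}" for t
    using M[of "a t"] M[of "b t"] that by auto
  then show ?thesis using that[of "max 1 M"] by (metis less_max_iff_disj max.coboundedI2 zero_less_one)
qed

text \<open>For \<lambda> \<le> 0 the product z v is nondecreasing, because its derivative a z root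
  r z - \<lambda> b v phi r v is a sum of nonnegative terms. It vanishes at both ends, hence
  throughout; then z = 0, so v is constant and equal to 0.\<close>

lemma eig_pos:
  assumes "eig lam"
  shows "lam > 0"
proof (rule ccontr)
  assume neg: "\<not> lam > 0"
  obtain v z t0 where S: "sol lam v z" "v A = 0" "v B = 0" "t0 \<in> {A<..<B}" "v t0 \<noteq> 0"
    using assms by (auto simp: eig_def)
  note S' = solD[OF S(1)]
  define h where "h = (\<lambda>t. z t * v t)"
  define h' where "h' = (\<lambda>t. a t * (z t * root r (z t)) - lam * b t * (v t * phi r (v t)))"
  have hc: "continuous_on {A..B} h" unfolding h_def by (intro continuous_intros S')
  have hd: "(h has_real_derivative h' t) (at t)" if "A < t" "t < B" for t
    unfolding h_def h'_def
    by (rule DERIV_mult[OF S'(4,3)[OF that], THEN DERIV_cong])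
      (simp add: algebra_simps)
  have sq: "z t * root r (z t) \<ge> 0" "v t * phi r (v t) \<ge> 0" for t
    by (simp_all only: mult_root_self[OF r] phi_mult_self[OF r]) simp_all
  have parts: "a t * (z t * root r (z t)) \<ge> 0" "- lam * b t * (v t * phi r (v t)) \<ge> 0"
    if "A < t" "t < B" for t
    using that neg ap[of t] bp[of t] by (intro mult_nonneg_nonneg sq; simp)+
  have h'n: "h' t \<ge> 0" if "A < t" "t < B" for t
    using parts[OF that] by (simp add: h'_def)
  have hdn: "\<exists>y. (h has_real_derivative y) (at t) \<and> 0 \<le> y" if "A < t" "t < B" for t
    using hd[OF that] h'n[OF that] by blast
  have h0: "h t = 0" if "A \<le> t" "t \<le> B" for t
  proof -
    have "h A \<le> h t"
      by (rule DERIV_nonneg_imp_increasing_open[where f = h])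
        (use that hdn in \<open>auto intro: continuous_on_subset[OF hc]\<close>)
    moreover have "h t \<le> h B"
      by (rule DERIV_nonneg_imp_increasing_open[where f = h])
        (use that hdn in \<open>auto intro: continuous_on_subset[OF hc]\<close>)
    ultimately show ?thesis using S by (simp add: h_def)
  qed
  have z0: "z t = 0" if "A < t" "t < B" for t
  proof -
    have "(h has_real_derivative 0) (at t)"
      by (rule has_field_derivative_transform_within_open[of "\<lambda>_. 0" _ _ "{A<..<B}"])
        (use that h0 in auto)
    then have "h' t = 0" using hd[OF that] DERIV_unique by blast
    then have "a t * (z t * root r (z t)) = 0" using parts[OF that] by (simp add: h'_def)
    then show ?thesis using ap[of t] that r by auto
  qed
  have "v t0 = v A"
  proof (rule DERIV_isconst_end[where f = v])
    show "A < t0" using S by simp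
    show "continuous_on {A..t0} v" using S by (auto intro: continuous_on_subset[OF S'(1)])
    show "(v has_real_derivative 0) (at x)" if "A < x" "x < t0" for x
      using S'(3)[of x] z0[of x] that S by simp
  qed
  then show False using S by simp
qed

text \<open>The energy |v|^(r+1) + |root r z|^(r+1) has derivative c * phi r v * root r z, and x^r y
  \<le> max x y ^ (r+1) bounds this by a multiple of the energy. A common zero of v and z would
  therefore annihilate the energy everywhere.\<close>

lemma sol_nonvanishing:
  assumes S: "sol lam v z" and "t0 \<in> {A..B}" "v t0 \<noteq> 0" and t: "t \<in> {A..B}"
  shows "v t \<noteq> 0 \<or> z t \<noteq> 0"
proof (rule ccontr)
  assume "\<not> (v t \<noteq> 0 \<or> z t \<noteq> 0)"
  then have z: "v t = 0" "z t = 0" by auto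
  note S' = solD[OF S]
  define E where "E = (\<lambda>t. \<bar>v t\<bar> ^ (r + 1) + z t * root r (z t))"
  define c where "c = (\<lambda>t. (real r + 1) * a t - (1 + 1 / real r) * lam * b t)"
  have "compact (c ` {A..B})"
    unfolding c_def by (intro compact_continuous_image continuous_intros ac bc) auto
  then obtain K where K: "\<And>t. t \<in> {A..B} \<Longrightarrow> \<bar>c t\<bar> \<le> K"
    by (metis bounded_iff compact_imp_bounded imageI real_norm_def)
  have Ey: "E t = \<bar>v t\<bar> ^ (r + 1) + \<bar>root r (z t)\<bar> ^ (r + 1)" for t
    by (simp only: E_def mult_root_self[OF r])
  have young: "\<bar>phi r (v t) * root r (z t)\<bar> \<le> \<bar>E t\<bar>" for t
  proof -
    let ?x = "\<bar>v t\<bar>" and ?y = "\<bar>root r (z t)\<bar>"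
    have "\<bar>phi r (v t) * root r (z t)\<bar> = ?x ^ r * ?y"
      using r phi_nonneg_eq[OF r, of ?x] by (simp add: phi_def abs_mult power_abs)
    also have "\<dots> \<le> max ?x ?y ^ r * max ?x ?y"
      by (intro mult_mono power_mono) auto
    also have "\<dots> = max ?x ?y ^ (r + 1)" by simp
    also have "\<dots> \<le> ?x ^ (r + 1) + ?y ^ (r + 1)"
      by (simp add: max_def del: power_Suc)
    finally show ?thesis by (simp add: Ey)
  qed
  have "E t0 = 0"
  proof (rule zero_propagates[where D = E and D' = "\<lambda>t. c t * (phi r (v t) * root r (z t))" and s = t and K = "\<bar>K\<bar>"])
    show "continuous_on {A..B} E" unfolding E_def by (intro continuous_intros S')
    fix t assume t: "A < t" "t < B"
    show "(E has_real_derivative c t * (phi r (v t) * root r (z t))) (at t)"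
      unfolding E_def
      by (rule DERIV_add[OF DERIV_chain2[OF DERIV_abs_power[OF r] S'(3)[OF t]]
            DERIV_chain2[OF DERIV_mult_root[OF r] S'(4)[OF t]], THEN DERIV_cong])
        (simp add: c_def algebra_simps)
    have "\<bar>c t\<bar> * \<bar>phi r (v t) * root r (z t)\<bar> \<le> \<bar>K\<bar> * \<bar>E t\<bar>"
      by (intro mult_mono young) (use K[of t] t in auto)
    then show "\<bar>c t * (phi r (v t) * root r (z t))\<bar> \<le> \<bar>K\<bar> * \<bar>E t\<bar>" by (simp add: abs_mult)
  qed (use assms t z r in \<open>auto simp: E_def\<close>)
  moreover have "E t0 > 0" using \<open>v t0 \<noteq> 0\<close> by (simp only: Ey) (intro add_pos_nonneg, auto)
  ultimately show False by simp
qed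

lemma riccati_z:
  assumes S: "sol lam v z" and t: "A < t" "t < B" and v: "v t \<noteq> 0"
  shows "((\<lambda>t. z t / phi r (v t)) has_real_derivative
     - lam * b t + (- real r * a t) * (z t / phi r (v t) * root r (z t / phi r (v t)))) (at t)"
proof -
  note S' = solD[OF S]
  have p: "phi r (v t) \<noteq> 0" "\<bar>v t\<bar> ^ (r - 1) = phi r (v t) / v t" using v by (auto simp: phi_def)
  have rt: "root r (z t / phi r (v t)) = root r (z t) / v t" using r by (simp add: real_root_divide)
  show ?thesis
    unfolding rt
    by (rule DERIV_divide[OF S'(4)[OF t] DERIV_chain2[OF DERIV_phi[OF r] S'(3)[OF t]] p(1), THEN DERIV_cong])
      (use v p in \<open>simp add: field_simps\<close>)
qed

lemma riccati_v:
  assumes S: "sol lam v z" and t: "A < t" "t < B" and z: "z t \<noteq> 0"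
  shows "((\<lambda>t. v t / root r (z t)) has_real_derivative
     a t + (lam * b t / real r) * \<bar>v t / root r (z t)\<bar> ^ (r + 1)) (at t)"
proof -
  note S' = solD[OF S]
  have p: "root r (z t) \<noteq> 0" using z r by simp
  have e: "\<bar>v t / root r (z t)\<bar> ^ (r + 1) = v t * phi r (v t) / (z t * root r (z t))"
    by (simp only: abs_divide power_divide mult_root_self[OF r] phi_mult_self[OF r])
  show ?thesis
    unfolding e
    by (rule DERIV_divide[OF S'(3)[OF t] DERIV_chain2[OF DERIV_root[OF r z] S'(4)[OF t]] p, THEN DERIV_cong])
      (use z p r in \<open>simp add: field_simps\<close>)
qed

text \<open>The system is not Lipschitz where \<open>z = 0\<close> (or, for the inverse ratio, where \<open>v = 0\<close>),
  so uniqueness up to scaling is obtained from the Riccati equations of the two ratios,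
  whose right-hand sides are \<open>C\<^sup>1\<close>.\<close>

lemma sol_projectively_unique:
  assumes S1: "sol lam v z" and S2: "sol lam V Z"
    and n1: "\<And>t. t \<in> {A..B} \<Longrightarrow> v t \<noteq> 0 \<or> z t \<noteq> 0"
    and n2: "\<And>t. t \<in> {A..B} \<Longrightarrow> V t \<noteq> 0 \<or> Z t \<noteq> 0"
    and A0: "v A = 0" "V A = 0" and t: "t \<in> {A..B}"
  shows "phi r (v t) * Z t = phi r (V t) * z t"
proof -
  note S1' = solD[OF S1] and S2' = solD[OF S2]
  \<comment> \<open>Equality of the ratios z / phi r v and Z / phi r V in cross-multiplied form,
    which makes sense at zeros as well. The truth of \<open>?P\<close> is shown to be locally
    constant on the connected interval, and it holds at A.\<close>
  let ?P = "\<lambda>t. phi r (v t) * Z t = phi r (V t) * z t"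
  obtain M where M: "\<And>t. t \<in> {A..B} \<Longrightarrow> a t \<le> M \<and> b t \<le> M" using coeff_bound by metis
  have near: "\<exists>d>0. \<forall>x\<in>{A..B}. dist x s < d \<longrightarrow> f x \<noteq> 0"
    if "continuous_on {A..B} f" "s \<in> {A..B}" "f s \<noteq> 0" for f :: "real \<Rightarrow> real" and s
    using continuous_on_eq_continuous_within[of "{A..B}" f] that
      continuous_within_avoid[of s "{A..B}" f 0] by (metis dist_commute)
  have nbd: "\<exists>T. openin (top_of_set {A..B}) T \<and> s \<in> T \<and> (\<forall>x\<in>T. \<forall>y\<in>T. ?P x \<longrightarrow> ?P y)"
    if s: "s \<in> {A..B}" for s
  proof -
    have "\<exists>d>0. \<forall>x\<in>{A..B} \<inter> ball s d. \<forall>y\<in>{A..B} \<inter> ball s d. ?P x \<longrightarrow> ?P y"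
    proof -
      \<comment> \<open>If \<open>?P s\<close> holds and v s = 0, then z s is nonzero, so V s = 0
        and Z s is nonzero; symmetrically in V. Hence one of the two ratios is regular for both
        solutions. Failure of \<open>?P\<close> is an open condition, so near such a point the
        implication is vacuous.\<close>
      consider "\<not> ?P s" | "?P s" "v s \<noteq> 0" "V s \<noteq> 0" | "?P s" "z s \<noteq> 0" "Z s \<noteq> 0"
        using n1[OF s] n2[OF s] by fastforce
      then show ?thesis
      proof cases
        case 1
        have "continuous_on {A..B} (\<lambda>t. phi r (v t) * Z t - phi r (V t) * z t)"
          by (intro continuous_intros S1' S2')
        from near[OF this s] 1 show ?thesis by (auto simp: dist_commute)
      next
        case 2
        obtain d1 d2 where d: "d1 > 0" "d2 > 0" "\<And>x. x \<in> {A..B} \<Longrightarrow> dist x s < d1 \<Longrightarrow> v x \<noteq> 0"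
          "\<And>x. x \<in> {A..B} \<Longrightarrow> dist x s < d2 \<Longrightarrow> V x \<noteq> 0"
          using near[OF S1'(1) s 2(2)] near[OF S2'(1) s 2(3)] by metis
        show ?thesis
        proof (intro exI[of _ "min d1 d2"] conjI ballI impI)
          fix x y assume xy: "x \<in> {A..B} \<inter> ball s (min d1 d2)" "y \<in> {A..B} \<inter> ball s (min d1 d2)" and P: "?P x"
          let ?I = "{min x y..max x y}"
          have I: "?I \<subseteq> {A..B}" using xy by auto
          have nz: "v t \<noteq> 0" "V t \<noteq> 0" if "t \<in> ?I" for t
          proof -
            have "dist t s < min d1 d2" using that xy by (auto simp: dist_real_def)
            moreover have "t \<in> {A..B}" using that I by blast
            ultimately show "v t \<noteq> 0" "V t \<noteq> 0" using d(3,4)[of t] by auto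
          qed
          have "z y / phi r (v y) = Z y / phi r (V y)"
          proof (rule scalar_ode_unique[where A = "min x y" and B = "max x y" and s = x and t = y
                and k = "\<lambda>x. x * root r x" and k' = "\<lambda>x. (1 + 1 / real r) * root r x"
                and al = "\<lambda>t. - lam * b t" and ga = "\<lambda>t. - real r * a t" and C = "real r * M"])
            show "continuous_on ?I (\<lambda>t. z t / phi r (v t))" "continuous_on ?I (\<lambda>t. Z t / phi r (V t))"
              using nz by (auto intro!: continuous_intros continuous_on_subset[OF S1'(1) I]
                  continuous_on_subset[OF S1'(2) I] continuous_on_subset[OF S2'(1) I] continuous_on_subset[OF S2'(2) I])
            fix t assume t: "min x y < t" "t < max x y"
            then have t': "A < t" "t < B" "t \<in> ?I" "t \<in> {A..B}" using I by auto
            show "((\<lambda>t. z t / phi r (v t)) has_real_derivative - lam * b t + - real r * a t * (z t / phi r (v t) * root r (z t / phi r (v t)))) (at t)"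
              using riccati_z[OF S1 t'(1,2)] nz[OF t'(3)] by simp
            show "((\<lambda>t. Z t / phi r (V t)) has_real_derivative - lam * b t + - real r * a t * (Z t / phi r (V t) * root r (Z t / phi r (V t)))) (at t)"
              using riccati_z[OF S2 t'(1,2)] nz[OF t'(3)] by simp
            show "\<bar>- real r * a t\<bar> \<le> real r * M"
              using M[OF t'(4)] ap[OF t'(4)] by (simp add: abs_mult mult_left_mono)
          next
            show "continuous_on UNIV (\<lambda>x. (1 + 1 / real r) * root r x)" by (intro continuous_intros)
            show "z x / phi r (v x) = Z x / phi r (V x)"
              using P nz[of x] by (auto simp: frac_eq_eq mult.commute)
          qed (use DERIV_mult_root[OF r] in auto)
          then show "?P y" using nz[of y] by (auto simp: frac_eq_eq mult.commute)
        qed (use d in auto)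
      next
        case 3
        obtain d1 d2 where d: "d1 > 0" "d2 > 0" "\<And>x. x \<in> {A..B} \<Longrightarrow> dist x s < d1 \<Longrightarrow> z x \<noteq> 0"
          "\<And>x. x \<in> {A..B} \<Longrightarrow> dist x s < d2 \<Longrightarrow> Z x \<noteq> 0"
          using near[OF S1'(2) s 3(2)] near[OF S2'(2) s 3(3)] by metis
        have eqP: "?P t \<longleftrightarrow> v t / root r (z t) = V t / root r (Z t)" if "z t \<noteq> 0" "Z t \<noteq> 0" for t
        proof -
          have "?P t \<longleftrightarrow> phi r (v t * root r (Z t)) = phi r (V t * root r (z t))"
            using r by (simp add: phi_mult)
          also have "\<dots> \<longleftrightarrow> v t * root r (Z t) = V t * root r (z t)" by (rule phi_inject[OF r])
          also have "\<dots> \<longleftrightarrow> v t / root r (z t) = V t / root r (Z t)"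
            using that r by (simp add: frac_eq_eq)
          finally show ?thesis .
        qed
        show ?thesis
        proof (intro exI[of _ "min d1 d2"] conjI ballI impI)
          fix x y assume xy: "x \<in> {A..B} \<inter> ball s (min d1 d2)" "y \<in> {A..B} \<inter> ball s (min d1 d2)" and P: "?P x"
          let ?I = "{min x y..max x y}"
          have I: "?I \<subseteq> {A..B}" using xy by auto
          have nz: "z t \<noteq> 0" "Z t \<noteq> 0" if "t \<in> ?I" for t
          proof -
            have "dist t s < min d1 d2" using that xy by (auto simp: dist_real_def)
            moreover have "t \<in> {A..B}" using that I by blast
            ultimately show "z t \<noteq> 0" "Z t \<noteq> 0" using d(3,4)[of t] by auto
          qed
          have "v y / root r (z y) = V y / root r (Z y)"
          proof (rule scalar_ode_unique[where A = "min x y" and B = "max x y" and s = x and t = y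
                and k = "\<lambda>x. \<bar>x\<bar> ^ (r + 1)" and k' = "\<lambda>x. (real r + 1) * phi r x"
                and al = a and ga = "\<lambda>t. lam * b t / real r" and C = "\<bar>lam\<bar> * M / real r"])
            show "continuous_on ?I (\<lambda>t. v t / root r (z t))" "continuous_on ?I (\<lambda>t. V t / root r (Z t))"
              using nz r by (auto intro!: continuous_intros continuous_on_subset[OF S1'(1) I]
                  continuous_on_subset[OF S1'(2) I] continuous_on_subset[OF S2'(1) I] continuous_on_subset[OF S2'(2) I])
            fix t assume t: "min x y < t" "t < max x y"
            then have t': "A < t" "t < B" "t \<in> ?I" "t \<in> {A..B}" using I by auto
            show "((\<lambda>t. v t / root r (z t)) has_real_derivative a t + lam * b t / real r * \<bar>v t / root r (z t)\<bar> ^ (r + 1)) (at t)"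
              using riccati_v[OF S1 t'(1,2)] nz[OF t'(3)] by simp
            show "((\<lambda>t. V t / root r (Z t)) has_real_derivative a t + lam * b t / real r * \<bar>V t / root r (Z t)\<bar> ^ (r + 1)) (at t)"
              using riccati_v[OF S2 t'(1,2)] nz[OF t'(3)] by simp
            show "\<bar>lam * b t / real r\<bar> \<le> \<bar>lam\<bar> * M / real r"
              using M[OF t'(4)] bp[OF t'(4)] by (simp add: abs_mult mult_left_mono divide_right_mono)
          next
            show "continuous_on UNIV (\<lambda>x. (real r + 1) * phi r x)" by (intro continuous_intros)
            show "v x / root r (z x) = V x / root r (Z x)" using P eqP[of x] nz[of x] by auto
          qed (use DERIV_abs_power[OF r] in auto)
          then show "?P y" using eqP[of y] nz[of y] by auto
        qed (use d in auto)
      qed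
    qed
    then obtain d where "d > 0" "\<forall>x\<in>{A..B} \<inter> ball s d. \<forall>y\<in>{A..B} \<inter> ball s d. ?P x \<longrightarrow> ?P y" by blast
    then show ?thesis using s
      by (intro exI[of _ "{A..B} \<inter> ball s d"]) (simp add: openin_open_Int)
  qed
  show ?thesis
  proof (rule connected_induction_simple[of "{A..B}" A t ?P])
    show "A \<in> {A..B}" "?P A" using AB A0 by auto
  qed (use t nbd in \<open>auto simp only: connected_Icc\<close>)
qed

section \<open>The angle at the right end as a function of the parameter m\<close>

lemma angle_exists:
  "\<exists>x. x A = 0 \<and> (\<forall>t\<in>{A..B}. (x has_real_derivative m * real r * pang r (a t) (b t) (x t)) (at t within {A..B}))"
proof -
  obtain M where M: "M > 0" "\<And>t. t \<in> {A..B} \<Longrightarrow> a t \<le> M \<and> b t \<le> M" using coeff_bound by metis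
  show ?thesis
  proof (rule picard_global[where L = "\<bar>m * real r\<bar> * (M * (2 * (real r + 3) * real r))"])
    show "continuous_on {A..B} (\<lambda>s. m * real r * pang r (a s) (b s) (x s))" if "continuous_on {A..B} x" for x
      by (intro continuous_on_mult continuous_on_const continuous_on_pang r ac bc that)
    fix s x y assume "A \<le> s" "s \<le> B"
    then have s: "s \<in> {A..B}" by simp
    have "\<bar>m * real r * pang r (a s) (b s) x - m * real r * pang r (a s) (b s) y\<bar>
       = \<bar>m * real r\<bar> * \<bar>pang r (a s) (b s) x - pang r (a s) (b s) y\<bar>"
      by (simp add: abs_mult flip: right_diff_distrib)
    also have "\<dots> \<le> \<bar>m * real r\<bar> * (M * (2 * (real r + 3) * real r) * \<bar>x - y\<bar>)"
      by (intro mult_left_mono pang_lipschitz[OF r]) (use M(2)[OF s] ap[OF s] bp[OF s] in auto)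
    finally show "\<bar>m * real r * pang r (a s) (b s) x - m * real r * pang r (a s) (b s) y\<bar>
       \<le> \<bar>m * real r\<bar> * (M * (2 * (real r + 3) * real r)) * \<bar>x - y\<bar>"
      by (simp only: mult.assoc)
  qed (use AB in auto)
qed

text \<open>The initial value 0 encodes v A = 0 through v = P sin \<beta>.\<close>

definition angle :: "real \<Rightarrow> real \<Rightarrow> real" where
  "angle m = (SOME x. x A = 0 \<and>
     (\<forall>t\<in>{A..B}. (x has_real_derivative m * real r * pang r (a t) (b t) (x t)) (at t within {A..B})))"

lemma angle_A: "angle m A = 0"
  and angle_deriv_within: "t \<in> {A..B} \<Longrightarrow>
    (angle m has_real_derivative m * real r * pang r (a t) (b t) (angle m t)) (at t within {A..B})"
  using someI_ex[OF angle_exists[of m]] unfolding angle_def by blast+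

lemma angle_deriv: "A < t \<Longrightarrow> t < B \<Longrightarrow>
    (angle m has_real_derivative m * real r * pang r (a t) (b t) (angle m t)) (at t)"
  using angle_deriv_within[of t m] by (simp add: at_within_Icc_at)

lemma continuous_on_angle: "continuous_on {A..B} (angle m)"
  using angle_deriv_within by (meson DERIV_continuous continuous_on_eq_continuous_within)

text \<open>Where the two angles coincide, their slopes differ by (m2 - m1) r times the positive
  \<open>pang\<close>. This includes the common starting point A.\<close>

lemma angle_strict_mono:
  assumes "0 < m1" "m1 < m2"
  shows "angle m1 B < angle m2 B"
proof -
  have "angle m2 B - angle m1 B > 0"
  proof (rule positive_after_crossing[where A = A and B = B and D = "\<lambda>t. angle m2 t - angle m1 t"])
    fix t assume t: "A \<le> t" "t \<le> B"
    then show "((\<lambda>t. angle m2 t - angle m1 t) has_real_derivative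
        m2 * real r * pang r (a t) (b t) (angle m2 t) - m1 * real r * pang r (a t) (b t) (angle m1 t)) (at t within {A..B})"
      by (intro DERIV_diff angle_deriv_within) auto
    assume "angle m2 t - angle m1 t = 0"
    moreover have "pang r (a t) (b t) (angle m1 t) > 0" using t by (intro pang_pos r ap bp) auto
    ultimately show "0 < m2 * real r * pang r (a t) (b t) (angle m2 t) - m1 * real r * pang r (a t) (b t) (angle m1 t)"
      using assms r by simp
  qed (use AB in \<open>auto simp: angle_A\<close>)
  then show ?thesis by simp
qed

text \<open>Excludes zero and negative multiples of pi, so that the enumeration of eigenvalues
  starts at k = 1.\<close>

lemma angle_B_pos:
  assumes "m > 0" shows "angle m B > 0"
proof -
  have "angle m A < angle m B"
  proof (rule DERIV_pos_imp_increasing_open[where f = "angle m", OF AB])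
    fix t assume t: "A < t" "t < B"
    then have "m * real r * pang r (a t) (b t) (angle m t) > 0"
      using assms r by (intro mult_pos_pos pang_pos ap bp) auto
    then show "\<exists>y. (angle m has_real_derivative y) (at t) \<and> 0 < y" using angle_deriv[OF t] by blast
  qed (rule continuous_on_angle)
  then show ?thesis by (simp add: angle_A)
qed

lemma isCont_angle_B: "isCont (\<lambda>m. angle m B) m"
proof -
  obtain M where M: "M > 0" "\<And>t. t \<in> {A..B} \<Longrightarrow> a t \<le> M \<and> b t \<le> M" using coeff_bound by metis
  define L where "L = M * (2 * (real r + 3) * real r)"
  define K where "K = \<bar>m * real r\<bar> * L"
  define C where "C = real r * (2 * M) * exp ((2 * K + 1) * (B - A))"
  have L: "L \<ge> 0" using M by (simp add: L_def)
  have bd: "\<bar>angle n B - angle m B\<bar> \<le> C * \<bar>n - m\<bar>" for n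
  proof -
    have "\<bar>angle n B - angle m B\<bar> \<le> \<bar>n - m\<bar> * (real r * (2 * M)) * exp ((2 * K + 1) * (B - A))"
    proof (rule gronwall_abs[where D = "\<lambda>t. angle n t - angle m t"])
      show "continuous_on {A..B} (\<lambda>t. angle n t - angle m t)"
        by (intro continuous_intros continuous_on_angle)
      fix t assume t: "A < t" "t < B"
      then have t': "t \<in> {A..B}" by simp
      let ?p = "\<lambda>x. pang r (a t) (b t) x"
      show "((\<lambda>t. angle n t - angle m t) has_real_derivative
         n * real r * ?p (angle n t) - m * real r * ?p (angle m t)) (at t)"
        by (intro DERIV_diff angle_deriv t)
      have p: "\<bar>?p x\<bar> \<le> 2 * M" for x
      proof -
        have "?p x \<le> (a t * pcos r x + b t * psin r x) / 1"
          unfolding pang_def using pden_ge_1[OF r, of x] pcos_psin_pos[OF r ap[OF t'] bp[OF t'], of x]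
          by (intro divide_left_mono) auto
        also have "\<dots> \<le> (M * 1 + M * 1) / 1"
          by (intro divide_right_mono add_mono mult_mono)
            (use M(1) M(2)[OF t'] in \<open>auto simp: pcos_le_1[OF r] psin_le_1 pcos_nonneg[OF r] psin_nonneg\<close>)
        finally show ?thesis using pang_pos[OF r ap[OF t'] bp[OF t'], of x] by simp
      qed
      have l: "\<bar>?p (angle n t) - ?p (angle m t)\<bar> \<le> L * \<bar>angle n t - angle m t\<bar>"
        unfolding L_def by (rule pang_lipschitz[OF r]) (use M(2)[OF t'] ap[OF t'] bp[OF t'] in auto)
      \<comment> \<open>Grouping this way puts only m, not n, into the Gronwall constant K; the
        resulting Lipschitz bound at m is therefore uniform in n.\<close>
      have "\<bar>n * real r * ?p (angle n t) - m * real r * ?p (angle m t)\<bar>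
        = \<bar>(n - m) * (real r * ?p (angle n t)) + (m * real r) * (?p (angle n t) - ?p (angle m t))\<bar>"
        by (simp add: algebra_simps)
      also have "\<dots> \<le> \<bar>n - m\<bar> * (real r * \<bar>?p (angle n t)\<bar>) + \<bar>m * real r\<bar> * \<bar>?p (angle n t) - ?p (angle m t)\<bar>"
        by (rule order.trans[OF abs_triangle_ineq]) (simp add: abs_mult)
      also have "\<dots> \<le> \<bar>n - m\<bar> * (real r * (2 * M)) + \<bar>m * real r\<bar> * (L * \<bar>angle n t - angle m t\<bar>)"
        by (intro add_mono mult_left_mono l p) auto
      finally show "\<bar>n * real r * ?p (angle n t) - m * real r * ?p (angle m t)\<bar>
        \<le> \<bar>n - m\<bar> * (real r * (2 * M)) + K * \<bar>angle n t - angle m t\<bar>"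
        by (simp add: K_def mult.assoc)
    qed (use AB M L in \<open>auto simp: angle_A K_def\<close>)
    then show ?thesis by (simp add: C_def mult_ac)
  qed
  have "((\<lambda>n. angle n B - angle m B) \<longlongrightarrow> 0) (at m)"
  proof (rule Lim_null_comparison)
    show "\<forall>\<^sub>F n in at m. norm (angle n B - angle m B) \<le> C * \<bar>n - m\<bar>" using bd by simp
    have "((\<lambda>n. C * \<bar>n - m\<bar>) \<longlongrightarrow> C * \<bar>m - m\<bar>) (at m)" by (intro tendsto_intros)
    then show "((\<lambda>n. C * \<bar>n - m\<bar>) \<longlongrightarrow> 0) (at m)" by simp
  qed
  then show ?thesis by (simp add: isCont_def LIM_zero_iff)
qed

lemma angle_sol:
  assumes m: "m > 0"
  shows "\<exists>V Z. sol (real r * m ^ (r + 1)) V Z \<and> (\<forall>t\<in>{A..B}. V t \<noteq> 0 \<or> Z t \<noteq> 0) \<and>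
    (\<forall>t\<in>{A..B}. V t = 0 \<longleftrightarrow> sin (angle m t) = 0)"
proof -
  define x where "x = angle m"
  have xc: "continuous_on {A..B} x" by (simp add: x_def continuous_on_angle)
  have den: "pden r (x t) > 0" for t using pden_ge_1[OF r, of "x t"] by simp
  \<comment> \<open>The logarithmic derivative of P, obtained by eliminating \<beta>' from the two
    equations. Taking P as an exponential keeps it positive, so V and Z vanish only with the sine
    and the cosine respectively.\<close>
  define l where "l = (\<lambda>t. m * (a t * root r (cos (x t)) * sin (x t) - real r * b t * phi r (sin (x t)) * cos (x t)) / pden r (x t))"
  have lc: "continuous_on {A..B} l"
  proof -
    have "\<forall>t\<in>{A..B}. real r * (cos (x t))\<^sup>2 + (sin (x t))\<^sup>2 \<noteq> 0"
      using den by (metis less_irrefl pden_def)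
    then show ?thesis
      unfolding l_def pden_def by (intro continuous_intros xc ac bc)
  qed
  define P where "P = (\<lambda>t. exp (integral {A..t} l))"
  have Pp: "P t > 0" for t by (simp add: P_def)
  have Pd: "(P has_real_derivative P t * l t) (at t)" if "A < t" "t < B" for t
  proof -
    have "((\<lambda>t. integral {A..t} l) has_real_derivative l t) (at t)"
      using integral_has_real_derivative[OF lc, of t] that by (simp add: at_within_Icc_at)
    then show ?thesis unfolding P_def by (rule DERIV_fun_exp[THEN DERIV_cong]) simp
  qed
  have Pc: "continuous_on {A..B} P"
    unfolding P_def by (intro continuous_on_exp indefinite_integral_continuous_1 integrable_continuous_interval lc)
  define V where "V = (\<lambda>t. P t * sin (x t))"
  define Z where "Z = (\<lambda>t. (m * P t) ^ r * cos (x t))"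
  have "sol (real r * m ^ (r + 1)) V Z"
    unfolding sol_def
  proof (intro conjI ballI)
    show "continuous_on {A..B} V" "continuous_on {A..B} Z"
      unfolding V_def Z_def by (intro continuous_intros Pc xc)+
    fix t assume "t \<in> {A<..<B}"
    then have t: "A < t" "t < B" by auto
    define s where "s = sin (x t)"
    define c where "c = cos (x t)"
    define y where "y = root r c"
    define q where "q = phi r s"
    define D where "D = pden r (x t)"
    have D: "D = real r * c\<^sup>2 + s\<^sup>2" "D > 0" using den[of t] by (auto simp: D_def pden_def s_def c_def)
    have xd: "(x has_real_derivative m * real r * ((a t * (c * y) + b t * (s * q)) / D)) (at t)"
      using angle_deriv[OF t, of m]
      by (simp add: x_def pang_def pcos_def psin_def s_def c_def y_def q_def D_def phi_mult_self[OF r])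
    have l: "l t = m * (a t * y * s - r * b t * q * c) / D"
      by (simp add: l_def s_def c_def y_def q_def D_def)
    have "root r (Z t) = m * P t * y"
      using r m Pp[of t] by (simp add: Z_def real_root_mult y_def c_def real_root_power_cancel)
    moreover have "(V has_real_derivative P t * l t * s + m * real r * ((a t * (c * y) + b t * (s * q)) / D) * c * P t) (at t)"
      unfolding V_def
      by (rule DERIV_mult[OF Pd[OF t] DERIV_chain2[OF DERIV_sin xd], THEN DERIV_cong])
        (simp add: s_def c_def mult_ac)
    moreover have "l t * s + m * real r * ((a t * (c * y) + b t * (s * q)) / D) * c = m * a t * y"
    proof -
      have "l t * s + m * real r * ((a t * (c * y) + b t * (s * q)) / D) * c = m * a t * y * (real r * c\<^sup>2 + s\<^sup>2) / D"
        using D(2) by (simp add: l field_simps power2_eq_square)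
      then show ?thesis using D by simp
    qed
    ultimately show "(V has_real_derivative a t * root r (Z t)) (at t)"
      by (elim DERIV_cong) (simp, algebra)
    have mP: "((\<lambda>t. (m * P t) ^ r) has_real_derivative real r * l t * (m * P t) ^ r) (at t)"
    proof -
      have "(m * P t) ^ (r - Suc 0) * (m * P t) = (m * P t) ^ r"
        using power_minus_mult[of r "m * P t"] r by simp
      moreover have "((\<lambda>t. (m * P t) ^ r) has_real_derivative
          real r * ((m * (P t * l t)) * (m * P t) ^ (r - Suc 0))) (at t)"
        by (intro DERIV_power DERIV_cmult Pd t)
      ultimately show ?thesis by (elim DERIV_cong) (metis mult.assoc mult.commute)
    qed
    define Y where "Y = m * real r * ((a t * (c * y) + b t * (s * q)) / D)"
    have zd: "(Z has_real_derivative real r * l t * (m * P t) ^ r * c + - s * Y * (m * P t) ^ r) (at t)"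
      unfolding Z_def
      by (rule DERIV_mult[OF mP DERIV_chain2[OF DERIV_cos xd], THEN DERIV_cong])
        (simp add: s_def c_def Y_def)
    have "real r * l t * c - s * Y = - (real r * m * b t * q) * (real r * c\<^sup>2 + s\<^sup>2) / D"
      using D(2) by (simp add: l Y_def field_simps power2_eq_square)
    then have e1: "real r * l t * c - s * Y = - (real r * m * b t * q)" using D by simp
    have e2: "- (real r * m ^ (r + 1)) * b t * phi r (V t) = - (real r * m * b t * q) * (m * P t) ^ r"
      using Pp[of t] phi_nonneg_eq[OF r, of "P t"]
      by (simp add: V_def phi_mult q_def s_def power_mult_distrib)
    have e3: "X * p * c + - s * Y * p = (X * c - s * Y) * p" for X p
      by (simp add: algebra_simps)
    show "(Z has_real_derivative - (real r * m ^ (r + 1)) * b t * phi r (V t)) (at t)"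
      using zd unfolding e2 e3 e1 .
  qed
  moreover have "V t \<noteq> 0 \<or> Z t \<noteq> 0" for t
  proof -
    have "sin (x t) \<noteq> 0 \<or> cos (x t) \<noteq> 0"
      by (metis sin_zero_norm_cos_one norm_zero zero_neq_one)
    then show ?thesis using Pp[of t] m by (auto simp: V_def Z_def)
  qed
  moreover have "V t = 0 \<longleftrightarrow> sin (angle m t) = 0" for t
    using Pp[of t] by (simp add: V_def x_def)
  ultimately show ?thesis by blast
qed

text \<open>An arbitrary eigenfunction has the same ratio as the solution built from the angle with
  the same \<lambda>, so both vanish together at B. Conversely, a solution built from the angle
  cannot have v = 0 on the open interval: then v' = 0 would force z = 0 there as well.\<close>

lemma eig_iff_angle:
  "eig lam \<longleftrightarrow> (\<exists>m>0. lam = real r * m ^ (r + 1) \<and> sin (angle m B) = 0)"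
proof
  assume e: "eig lam"
  define m where "m = root (r + 1) (lam / r)"
  have "m ^ (r + 1) = lam / real r"
    unfolding m_def using eig_pos[OF e] r by (intro real_root_pow_pos2) auto
  then have m: "m > 0" "lam = real r * m ^ (r + 1)"
    using eig_pos[OF e] r by (auto simp: m_def simp del: power_Suc)
  obtain V Z where VZ: "sol lam V Z" "\<And>t. t \<in> {A..B} \<Longrightarrow> V t \<noteq> 0 \<or> Z t \<noteq> 0"
    "\<And>t. t \<in> {A..B} \<Longrightarrow> V t = 0 \<longleftrightarrow> sin (angle m t) = 0"
    using angle_sol[OF m(1)] m(2) by metis
  obtain v z t0 where S: "sol lam v z" "v A = 0" "v B = 0" "t0 \<in> {A<..<B}" "v t0 \<noteq> 0"
    using e by (auto simp: eig_def)
  have t0: "t0 \<in> {A..B}" using S by auto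
  have nv: "v t \<noteq> 0 \<or> z t \<noteq> 0" if "t \<in> {A..B}" for t
    using sol_nonvanishing[OF S(1) t0 S(5) that] .
  have "V A = 0" using VZ(3)[of A] AB by (simp add: angle_A)
  then have "phi r (v B) * Z B = phi r (V B) * z B"
    using sol_projectively_unique[OF S(1) VZ(1) nv VZ(2) S(2)] AB by simp
  \<comment> \<open>Since v B = 0, the left side of the identity vanishes, while z B is
    nonzero.\<close>
  then have "V B = 0" using S(3) nv[of B] AB by simp
  then show "\<exists>m>0. lam = real r * m ^ (r + 1) \<and> sin (angle m B) = 0" using m VZ(3)[of B] AB by auto
next
  assume "\<exists>m>0. lam = real r * m ^ (r + 1) \<and> sin (angle m B) = 0"
  then obtain m where m: "m > 0" "lam = real r * m ^ (r + 1)" "sin (angle m B) = 0" by blast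
  obtain V Z where VZ: "sol lam V Z" "\<And>t. t \<in> {A..B} \<Longrightarrow> V t \<noteq> 0 \<or> Z t \<noteq> 0"
    "\<And>t. t \<in> {A..B} \<Longrightarrow> V t = 0 \<longleftrightarrow> sin (angle m t) = 0"
    using angle_sol[OF m(1)] m(2) by metis
  have "\<exists>t\<in>{A<..<B}. V t \<noteq> 0"
  proof (rule ccontr)
    assume "\<not> ?thesis"
    then have V0: "V t = 0" if "A < t" "t < B" for t using that by auto
    define t where "t = (A + B) / 2"
    have t: "A < t" "t < B" using AB by (auto simp: t_def)
    have "(V has_real_derivative 0) (at t)"
      by (rule has_field_derivative_transform_within_open[of "\<lambda>_. 0" _ _ "{A<..<B}"])
        (use t V0 in auto)
    then have "a t * root r (Z t) = 0" using solD(3)[OF VZ(1) t] DERIV_unique by blast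
    then show False using ap[of t] VZ(2)[of t] V0[OF t] t r by auto
  qed
  moreover have "V A = 0" "V B = 0" using VZ(3)[of A] VZ(3)[of B] m AB by (auto simp: angle_A)
  ultimately show "eig lam" unfolding eig_def using VZ(1) by blast
qed

text \<open>Along the solution the arc length grows at m times a weighted mean of a and b, with
  weights proportional to \<open>pcos\<close> and \<open>psin\<close>; the factors
  \<open>pden\<close> and r cancel.\<close>

lemma angle_length_bounds:
  assumes G: "\<And>x. (G has_real_derivative pgen r x) (at x)" "G 0 = 0" and m: "m > 0"
    and lo: "\<And>t. t \<in> {A..B} \<Longrightarrow> lo \<le> a t \<and> lo \<le> b t"
    and hi: "\<And>t. t \<in> {A..B} \<Longrightarrow> a t \<le> hi \<and> b t \<le> hi"
  shows "m * lo * (B - A) \<le> G (angle m B)" "G (angle m B) \<le> m * hi * (B - A)"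
proof -
  define d where "d = (\<lambda>t. m * ((a t * pcos r (angle m t) + b t * psin r (angle m t)) / (pcos r (angle m t) + psin r (angle m t))))"
  have Gd: "((\<lambda>t. G (angle m t)) has_real_derivative d t) (at t)" if t: "A < t" "t < B" for t
  proof (rule DERIV_chain2[OF G(1) angle_deriv[OF t], THEN DERIV_cong])
    have "pden r (angle m t) \<noteq> 0" using pden_ge_1[OF r, of "angle m t"] by auto
    then show "pgen r (angle m t) * (m * real r * pang r (a t) (b t) (angle m t)) = d t"
      using r by (simp add: pgen_def pang_def d_def)
  qed
  have db: "m * lo \<le> d t" "d t \<le> m * hi" if "A < t" "t < B" for t
  proof -
    let ?c = "pcos r (angle m t)" and ?s = "psin r (angle m t)"
    have p: "?c + ?s > 0" using pcos_psin_pos[OF r, of 1 1] by simp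
    have "lo * ?c \<le> a t * ?c" "lo * ?s \<le> b t * ?s" "a t * ?c \<le> hi * ?c" "b t * ?s \<le> hi * ?s"
      using lo[of t] hi[of t] that by (auto intro!: mult_right_mono pcos_nonneg r psin_nonneg)
    then have "lo * (?c + ?s) \<le> a t * ?c + b t * ?s" "a t * ?c + b t * ?s \<le> hi * (?c + ?s)"
      unfolding distrib_left by linarith+
    then have "lo \<le> (a t * ?c + b t * ?s) / (?c + ?s)" "(a t * ?c + b t * ?s) / (?c + ?s) \<le> hi"
      using p by (simp_all add: pos_le_divide_eq pos_divide_le_eq)
    then show "m * lo \<le> d t" "d t \<le> m * hi"
      unfolding d_def using m by (intro mult_left_mono; simp)+
  qed
  have Gc: "continuous_on {A..B} (\<lambda>t. G (angle m t))"
  proof (rule continuous_on_compose2[OF _ continuous_on_angle])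
    show "continuous_on UNIV G" using G(1) by (meson DERIV_isCont continuous_at_imp_continuous_on)
  qed auto
  have "G (angle m A) - m * lo * A \<le> G (angle m B) - m * lo * B"
  proof (rule DERIV_nonneg_imp_increasing_open[where f = "\<lambda>t. G (angle m t) - m * lo * t"])
    fix t assume t: "A < t" "t < B"
    have "((\<lambda>t. G (angle m t) - m * lo * t) has_real_derivative d t - m * lo * 1) (at t)"
      by (intro DERIV_diff Gd t DERIV_cmult DERIV_ident)
    then show "\<exists>y. ((\<lambda>t. G (angle m t) - m * lo * t) has_real_derivative y) (at t) \<and> 0 \<le> y"
      using db[OF t] by (intro exI[of _ "d t - m * lo * 1"]) auto
  qed (use AB in \<open>auto intro!: continuous_intros Gc\<close>)
  then show "m * lo * (B - A) \<le> G (angle m B)" by (simp add: angle_A G(2) algebra_simps)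
  have "m * hi * A - G (angle m A) \<le> m * hi * B - G (angle m B)"
  proof (rule DERIV_nonneg_imp_increasing_open[where f = "\<lambda>t. m * hi * t - G (angle m t)"])
    fix t assume t: "A < t" "t < B"
    have "((\<lambda>t. m * hi * t - G (angle m t)) has_real_derivative m * hi * 1 - d t) (at t)"
      by (intro DERIV_diff Gd t DERIV_cmult DERIV_ident)
    then show "\<exists>y. ((\<lambda>t. m * hi * t - G (angle m t)) has_real_derivative y) (at t) \<and> 0 \<le> y"
      using db[OF t] by (intro exI[of _ "m * hi * 1 - d t"]) auto
  qed (use AB in \<open>auto intro!: continuous_intros Gc\<close>)
  then show "G (angle m B) \<le> m * hi * (B - A)" by (simp add: angle_A G(2) algebra_simps)
qed

text \<open>\<open>sin (angle m B) = 0\<close> selects the \<open>m\<close> with \<open>angle m B = k * pi\<close>, and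
  \<open>m \<mapsto> angle m B\<close> is continuous and strictly increasing.\<close>

lemma eig_structure:
  fixes lo hi :: real
  defines "w \<equiv> \<lambda>k::nat. real k * (2 * pi / ((real r + 1) * sin (pi / (real r + 1))))"
  assumes lo0: "lo > 0" and lo: "\<And>t. t \<in> {A..B} \<Longrightarrow> lo \<le> a t \<and> lo \<le> b t"
    and hi: "\<And>t. t \<in> {A..B} \<Longrightarrow> a t \<le> hi \<and> b t \<le> hi"
  obtains mu :: "nat \<Rightarrow> real" where "strict_mono_on {1..} mu" "Collect eig = mu ` {1..}"
    "\<And>k. k \<ge> 1 \<Longrightarrow> r * (w k / (hi * (B - A))) ^ (r + 1) \<le> mu k"
    "\<And>k. k \<ge> 1 \<Longrightarrow> mu k \<le> r * (w k / (lo * (B - A))) ^ (r + 1)"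
proof -
  obtain G where G: "\<And>x. (G has_real_derivative pgen r x) (at x)" "G 0 = 0" "\<And>k. G (real k * pi) = w k"
    using pruefer_length[OF r] unfolding w_def by metis
  have Gmono: "G x < G y" if "x < y" for x y
  proof (rule DERIV_pos_imp_increasing[where f = G, OF that])
    fix x
    have "pgen r x > 0" unfolding pgen_def using pden_ge_1[OF r, of x] pgen_nonzero[OF r, of x]
      by (intro divide_pos_pos) auto
    then show "\<exists>y. (G has_real_derivative y) (at x) \<and> 0 < y" using G(1) by blast
  qed
  have Gle: "x \<le> y" if "G x \<le> G y" for x y using Gmono[of y x] that by force
  have wpos: "w k > 0" if "k \<ge> 1" for k
    using Gmono[of 0 "real k * pi"] that G(2,3) by simp
  have "lo \<le> hi" using lo[of A] hi[of A] AB by auto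
  then have hi0: "hi > 0" using lo0 by simp
  note bounds = angle_length_bounds[OF G(1,2) _ lo hi]
  have BA: "B - A > 0" using AB by simp
  have "\<exists>m>0. angle m B = real k * pi" if k: "k \<ge> 1" for k
  proof -
    \<comment> \<open>The length bounds put the arc length at most w k for m1 and at least w k for
      m2, so these two values bracket the solution in the intermediate value theorem.\<close>
    define m1 where "m1 = w k / (hi * (B - A))"
    define m2 where "m2 = w k / (lo * (B - A))"
    have m: "m1 > 0" "m2 > 0" "m1 \<le> m2"
      using wpos[OF k] hi0 lo0 BA \<open>lo \<le> hi\<close>
      by (auto simp: m1_def m2_def intro!: divide_left_mono mult_right_mono)
    have "G (angle m1 B) \<le> G (real k * pi)"
      using bounds(2)[OF m(1)] hi0 BA by (simp add: m1_def G(3))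
    moreover have "G (real k * pi) \<le> G (angle m2 B)"
      using bounds(1)[OF m(2)] lo0 BA by (simp add: m2_def G(3))
    ultimately have "\<exists>m\<ge>m1. m \<le> m2 \<and> angle m B = real k * pi"
      using m(3) isCont_angle_B by (intro IVT[where f = "\<lambda>m. angle m B"] allI impI) (simp_all add: Gle)
    then obtain m where "m1 \<le> m" "angle m B = real k * pi" by blast
    then show ?thesis using m(1) by (intro exI[of _ m]) simp
  qed
  then obtain M where M: "\<And>k. k \<ge> 1 \<Longrightarrow> M k > 0 \<and> angle (M k) B = real k * pi" by metis
  define mu where "mu = (\<lambda>k. real r * M k ^ (r + 1))"
  have angle_le: "m1 \<le> m2" if "angle m1 B \<le> angle m2 B" "m2 > 0" for m1 m2
    using angle_strict_mono[of m2 m1] that by force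
  show ?thesis
  proof (rule that[of mu])
    show "strict_mono_on {1..} mu"
    proof (rule strict_mono_onI)
      fix j k :: nat assume jk: "j \<in> {1..}" "k \<in> {1..}" "j < k"
      have "M j < M k"
      proof (rule ccontr)
        assume "\<not> M j < M k"
        then have "angle (M k) B \<le> angle (M j) B"
          using angle_strict_mono[of "M k" "M j"] M[of k] jk by (cases "M k = M j") auto
        then show False using M[of j] M[of k] jk by simp
      qed
      then show "mu j < mu k"
        unfolding mu_def using r M[of j] jk by (intro mult_strict_left_mono power_strict_mono) auto
    qed
    show "Collect eig = mu ` {1..}"
    proof (intro set_eqI iffI)
      fix lam assume "lam \<in> Collect eig"
      then obtain m where m: "m > 0" "lam = real r * m ^ (r + 1)" "sin (angle m B) = 0"
        by (auto simp: eig_iff_angle)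
      obtain i :: int where i: "angle m B = of_int i * pi" using m(3) by (auto simp: sin_zero_iff_int2)
      have "0 < of_int i * pi" using angle_B_pos[OF m(1)] i by simp
      then have "i > 0" by (simp add: zero_less_mult_iff)
      define k where "k = nat i"
      have k: "k \<ge> 1" "angle m B = real k * pi" using \<open>i > 0\<close> i by (auto simp: k_def)
      then have "m = M k" using angle_le[of m "M k"] angle_le[of "M k" m] M[of k] m(1) by force
      then show "lam \<in> mu ` {1..}" using m k by (auto simp: mu_def)
    next
      fix lam assume "lam \<in> mu ` {1..}"
      then obtain k where k: "k \<ge> 1" "lam = mu k" by auto
      then have "sin (angle (M k) B) = 0" using M[of k] by simp
      then show "lam \<in> Collect eig" using k M[of k] by (auto simp: eig_iff_angle mu_def)
    qed
    fix k :: nat assume k: "k \<ge> 1"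
    have Mk: "M k > 0" "G (angle (M k) B) = w k" using M[OF k] G(3) by auto
    have "w k / (hi * (B - A)) \<le> M k" "M k \<le> w k / (lo * (B - A))"
      using bounds[OF Mk(1)] Mk(2) hi0 lo0 BA by (auto simp: field_simps)
    then show "r * (w k / (hi * (B - A))) ^ (r + 1) \<le> mu k" "mu k \<le> r * (w k / (lo * (B - A))) ^ (r + 1)"
      unfolding mu_def using wpos[OF k] hi0 lo0 BA Mk
      by (auto intro!: mult_left_mono power_mono simp del: power_Suc)
  qed
qed

end

section \<open>Radial solutions of the partial differential equation\<close>

text \<open>For r = 1 the two powers disagree at s = 0, as \<open>0 powr 0 = 0\<close> but
  \<open>0 ^ 0 = 1\<close>; the factor s makes both products 0.\<close>

lemma abs_powr_mult_eq_phi: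
  assumes "r \<ge> 1"
  shows "\<bar>s\<bar> powr (real r + 1 - 2) * s = phi r s"
proof (cases "s = 0")
  case False
  have "real r + 1 - 2 = real (r - 1)" using assms by (simp add: of_nat_diff)
  moreover have "\<bar>s\<bar> powr real (r - 1) = \<bar>s\<bar> ^ (r - 1)"
    using False by (intro powr_realpow) simp
  ultimately have "\<bar>s\<bar> powr (real r + 1 - 2) = \<bar>s\<bar> ^ (r - 1)" by (simp only:)
  then show ?thesis by (simp add: phi_def)
qed simp

section \<open>Annuli, and the divergence and gradient of radial fields\<close>

lemma open_annulus: "open (annulus R S)"
  unfolding annulus_def by (intro open_Collect_conj open_Collect_less continuous_intros)

lemma closure_annulus:
  assumes "0 < R" "R < S"
  shows "closure (annulus R S :: 'a::real_normed_vector set) = {x. R \<le> norm x \<and> norm x \<le> S}"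
proof (intro equalityI subsetI)
  fix x :: 'a assume "x \<in> closure (annulus R S)"
  moreover have "closure (annulus R S) \<subseteq> {x :: 'a. R \<le> norm x \<and> norm x \<le> S}"
    by (rule closure_minimal)
      (auto simp: annulus_def intro!: closed_Collect_conj closed_Collect_le continuous_intros)
  ultimately show "x \<in> {x. R \<le> norm x \<and> norm x \<le> S}" by blast
next
  fix x :: 'a assume x: "x \<in> {x. R \<le> norm x \<and> norm x \<le> S}"
  then have nz: "norm x > 0" using assms by auto
  let ?f = "\<lambda>t. (t / norm x) *\<^sub>R x"
  \<comment> \<open>A boundary point is approached along its own ray, which reduces the claim to the
    closure of a real interval.\<close>
  have "?f ` closure {R<..<S} \<subseteq> closure (annulus R S)"
  proof (rule image_closure_subset)
    show "continuous_on (closure {R<..<S}) ?f" using nz by (intro continuous_intros) auto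
    show "?f ` {R<..<S} \<subseteq> closure (annulus R S)"
      using nz assms by (auto intro!: subsetD[OF closure_subset] simp: annulus_def)
  qed simp
  moreover have "norm x \<in> closure {R<..<S}" using x assms by simp
  ultimately have "?f (norm x) \<in> closure (annulus R S)" by blast
  then show "x \<in> closure (annulus R S)" using nz by simp
qed

lemma frontier_annulus:
  assumes "0 < R" "R < S"
  shows "frontier (annulus R S :: 'a::real_normed_vector set) = {x. norm x = R \<or> norm x = S}"
  unfolding frontier_def closure_annulus[OF assms] interior_open[OF open_annulus]
  using assms by (auto simp: annulus_def)

lemma has_divergence_unique:
  assumes "has_divergence F d x" "has_divergence F d' x" shows "d = d'"
  using assms has_derivative_unique unfolding has_divergence_def by blast

lemma has_divergence_transform:
  assumes "has_divergence F d x" "open U" "x \<in> U" "\<And>y. y \<in> U \<Longrightarrow> F y = G y"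
  shows "has_divergence G d x"
proof -
  obtain F' where "(F has_derivative F') (at x)" "d = (\<Sum>b\<in>Basis. F' b \<bullet> b)"
    using assms(1) by (auto simp: has_divergence_def)
  moreover from this(1) have "(G has_derivative F') (at x)"
    using assms(2,3,4) by (rule has_derivative_transform_within_open)
  ultimately show ?thesis by (auto simp: has_divergence_def)
qed

lemma has_derivative_norm_at:
  fixes x :: "'a::real_inner"
  assumes "x \<noteq> 0"
  shows "(norm has_derivative (\<lambda>h. (x \<bullet> h) / norm x)) (at x)"
  by (rule has_derivative_eq_rhs[OF has_derivative_norm[OF assms]])
    (simp add: sgn_div_norm inner_commute divide_inverse mult.commute fun_eq_iff)

text \<open>With c = |x| and k the derivative of w(t)/t at c, the derivative of the field is h ->
  (w/c) h + (k/c) (x . h) x, whose trace is N w/c + k c.\<close>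

lemma has_divergence_radial:
  fixes x :: "'a::euclidean_space"
  assumes "x \<noteq> 0" and w: "(w has_real_derivative w') (at (norm x))"
  shows "has_divergence (\<lambda>y. (w (norm y) / norm y) *\<^sub>R y)
    (w' + (real DIM('a) - 1) * w (norm x) / norm x) x"
proof -
  define c where "c = norm x"
  have c: "c > 0" using assms by (simp add: c_def)
  define k where "k = (w' * c - w c) / (c * c)"
  have "((\<lambda>t. w t / t) has_real_derivative k) (at c)"
    using DERIV_divide[OF w DERIV_ident, folded c_def] c by (simp add: k_def)
  then have "((\<lambda>t. w t / t) has_derivative (\<lambda>h. k * h)) (at (norm x))"
    by (simp add: has_field_derivative_def c_def)
  then have "((\<lambda>y. w (norm y) / norm y) has_derivative (\<lambda>h. k * ((x \<bullet> h) / c))) (at x)"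
    unfolding c_def by (rule has_derivative_compose[OF has_derivative_norm_at[OF assms(1)]])
  then have D: "((\<lambda>y. (w (norm y) / norm y) *\<^sub>R y) has_derivative
      (\<lambda>h. (w c / c) *\<^sub>R h + (k * ((x \<bullet> h) / c)) *\<^sub>R x)) (at x)"
    using has_derivative_scaleR[OF _ has_derivative_ident] by (fastforce simp: c_def)
  have "(\<Sum>b\<in>Basis. ((w c / c) *\<^sub>R b + (k * ((x \<bullet> b) / c)) *\<^sub>R x) \<bullet> b)
      = (\<Sum>b\<in>Basis. w c / c + k / c * ((x \<bullet> b) * (x \<bullet> b)))"
    by (intro sum.cong) (auto simp: inner_add_left)
  also have "\<dots> = real DIM('a) * (w c / c) + k / c * (\<Sum>b\<in>Basis. (x \<bullet> b) * (x \<bullet> b))"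
    by (simp add: sum.distrib sum_distrib_left)
  also have "(\<Sum>b\<in>Basis. (x \<bullet> b) * (x \<bullet> b)) = c * c"
    unfolding euclidean_inner[symmetric] c_def by (metis power2_eq_square power2_norm_eq_inner)
  also have "real DIM('a) * (w c / c) + k / c * (c * c) = w' + (real DIM('a) - 1) * w c / c"
  proof -
    have "k / c * (c * c) = k * c" using c by simp
    also have "\<dots> = (w' * c - w c) / c" using c by (simp add: k_def)
    also have "\<dots> = w' - w c / c" using c by (simp add: diff_divide_distrib)
    finally have "k / c * (c * c) = w' - w c / c" .
    moreover have "(n - 1) * w c / c = n * (w c / c) - w c / c" for n
      by (simp add: left_diff_distrib diff_divide_distrib)
    ultimately show ?thesis by simp
  qed
  finally have tr: "(\<Sum>b\<in>Basis. ((w c / c) *\<^sub>R b + (k * ((x \<bullet> b) / c)) *\<^sub>R x) \<bullet> b)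
      = w' + (real DIM('a) - 1) * w c / c" .
  show ?thesis
    unfolding has_divergence_def c_def[symmetric] by (intro exI conjI, rule D, rule tr[symmetric])
qed

lemma gderiv_radial:
  fixes x :: "'a::real_inner"
  assumes "x \<noteq> 0" and v: "(v has_real_derivative v') (at (norm x))"
  shows "GDERIV (\<lambda>y. v (norm y)) x :> (v' / norm x) *\<^sub>R x"
proof -
  have "(v has_derivative (\<lambda>h. v' * h)) (at (norm x))"
    using v by (simp add: has_field_derivative_def)
  from has_derivative_compose[OF has_derivative_norm_at[OF assms(1)] this]
  show ?thesis by (simp add: gderiv_def inner_commute)
qed

lemma gderiv_unique:
  assumes "GDERIV u x :> g" "GDERIV u x :> g'" shows "g = g'"
proof -
  have "(\<lambda>h. inner h g) = (\<lambda>h. inner h g')"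
    using assms has_derivative_unique unfolding gderiv_def by blast
  then show ?thesis by (metis vector_eq_ldot)
qed

lemma norm_powr_scaleR_radial:
  fixes y :: "'a::real_normed_vector"
  assumes "r \<ge> 1" "y \<noteq> 0" and g: "g = (s / norm y) *\<^sub>R y"
  shows "(norm g powr (real r + 1 - 2)) *\<^sub>R g = (phi r s / norm y) *\<^sub>R y"
proof -
  have "norm g = \<bar>s\<bar>" using assms by (simp add: g)
  then have "(norm g powr (real r + 1 - 2)) *\<^sub>R g = (\<bar>s\<bar> powr (real r + 1 - 2) * s / norm y) *\<^sub>R y"
    by (simp add: g)
  then show ?thesis unfolding abs_powr_mult_eq_phi[OF assms(1)] .
qed

text \<open>Inside the interval z differs from the integral of f by a constant, and that integral is
  continuous up to the ends. It supplies the boundary values of the flux, which the Dirichlet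
  problem itself gives only in the open annulus.\<close>

lemma continuous_extension_of_primitive:
  fixes z f :: "real \<Rightarrow> real"
  assumes AB: "A < B" and fc: "continuous_on {A..B} f"
    and z: "\<And>t. A < t \<Longrightarrow> t < B \<Longrightarrow> (z has_real_derivative f t) (at t)"
  obtains zz where "continuous_on {A..B} zz" "\<And>t. A < t \<Longrightarrow> t < B \<Longrightarrow> zz t = z t"
proof -
  define J where "J = (\<lambda>t. integral {A..t} f)"
  have Jc: "continuous_on {A..B} J"
    unfolding J_def by (intro indefinite_integral_continuous_1 integrable_continuous_interval fc)
  have Jd: "(J has_real_derivative f t) (at t)" if "A < t" "t < B" for t
    using integral_has_real_derivative[OF fc, of t] that by (simp add: J_def at_within_Icc_at)
  define c where "c = (A + B) / 2"
  have c: "A < c" "c < B" using AB by (auto simp: c_def)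
  have "z t - J t = z c - J c" if "A < t" "t < B" for t
  proof (rule DERIV_isconst3[where f = "\<lambda>t. z t - J t" and a = A and b = B])
    fix x assume "x \<in> {A<..<B}"
    then have "((\<lambda>t. z t - J t) has_real_derivative f x - f x) (at x)"
      by (intro DERIV_diff z Jd) auto
    then show "((\<lambda>t. z t - J t) has_real_derivative 0) (at x)" by simp
  qed (use that c AB in auto)
  then have "J t + (z c - J c) = z t" if "A < t" "t < B" for t
    using that by (simp add: algebra_simps)
  moreover have "continuous_on {A..B} (\<lambda>t. J t + (z c - J c))" by (intro continuous_intros Jc)
  ultimately show ?thesis using that by blast
qed

text \<open>The variable \<open>z = (\<rho> / R) ^ (2 r) phi r v'\<close> is normalised so that both coefficients of the
  first-order system are close to \<open>1\<close> on a thin annulus of large radius.\<close>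

abbreviation coef_a :: "real \<Rightarrow> real \<Rightarrow> real" where
  "coef_a R t \<equiv> (R / t)\<^sup>2"

abbreviation coef_b :: "nat \<Rightarrow> real \<Rightarrow> real \<Rightarrow> real" where
  "coef_b r R t \<equiv> (t / R) ^ (2 * r)"

lemma half_linear_radial:
  assumes "r \<ge> 1" "0 < R" "R < S"
  shows "half_linear r R S (coef_a R) (coef_b r R)"
  by unfold_locales (use assms in \<open>auto intro!: continuous_intros\<close>)

text \<open>The identity \<open>phi r (coef_a R t) = 1 / coef_b r R t\<close> makes v' = a root r z
  equivalent to z = b phi r v'.\<close>

lemma radial_flux_unscale:
  assumes "r \<ge> 1" "R > 0" "t > 0"
  shows "phi r (coef_a R t * root r z) = z / coef_b r R t"
    "coef_a R t * root r (coef_b r R t * phi r s) = s"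
proof -
  have pow: "phi r (coef_a R t) = 1 / coef_b r R t"
    using assms by (simp add: phi_nonneg_eq power_divide flip: power_mult)
  show "phi r (coef_a R t * root r z) = z / coef_b r R t"
    unfolding phi_mult pow using assms by simp
  have "phi r (coef_a R t * root r (coef_b r R t * phi r s)) = phi r s"
    unfolding phi_mult pow using assms by simp
  then show "coef_a R t * root r (coef_b r R t * phi r s) = s"
    using assms by (simp add: phi_inject)
qed

lemma DERIV_coef_b:
  assumes "r \<ge> 1" "R > 0" "t > 0"
  shows "(coef_b r R has_real_derivative coef_b r R t * (2 * real r / t)) (at t)"
proof -
  have "(t / R) ^ (2 * r) = (t / R) ^ (2 * r - Suc 0) * (t / R)"
    using power_minus_mult[of "2 * r" "t / R"] assms by simp
  then have e: "coef_b r R t * (2 * real r / t) = (t / R) ^ (2 * r - Suc 0) * (t / R) * (2 * real r / t)"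
    by (rule arg_cong)
  have "((\<lambda>t. (t / R) ^ (2 * r)) has_real_derivative real (2 * r) * (1 / R * (t / R) ^ (2 * r - Suc 0))) (at t)"
    by (intro DERIV_power DERIV_cdivide DERIV_ident)
  moreover have "real (2 * r) * (1 / R * q) = q * (t / R) * (2 * real r / t)" for q
    using assms by simp
  ultimately show ?thesis unfolding e by simp
qed

text \<open>Restriction to a ray through a unit vector e. Radial symmetry forces the gradient to be
  radial, and multiplying the flux by \<open>coef_b\<close> absorbs the term (N - 1) w / \<rho> of
  the divergence.\<close>

lemma radial_eigenvalue_imp_eig:
  assumes r: "r \<ge> 1" and RS: "0 < R" "R < S" and dim: "DIM('a::euclidean_space) = 2 * r + 1"
    and lam: "lam \<in> radial_eigenvalues TYPE('a) (real r + 1) R S"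
  shows "half_linear.eig r R S (coef_a R) (coef_b r R) lam"
proof -
  interpret half_linear r R S "coef_a R" "coef_b r R" using half_linear_radial[OF r RS] .
  let ?O = "annulus R S :: 'a set"
  obtain u where u: "p_laplace_dirichlet_solution (real r + 1) lam ?O u" "radial_on ?O u" "\<exists>x\<in>?O. u x \<noteq> 0"
    using lam by (auto simp: radial_eigenvalues_def)
  have uc: "continuous_on (closure ?O) u" and u0: "\<And>x. x \<in> frontier ?O \<Longrightarrow> u x = 0"
    using u(1) by (auto simp: p_laplace_dirichlet_solution_def)
  obtain g where g: "\<And>x. x \<in> ?O \<Longrightarrow> GDERIV u x :> g x"
    and dv: "\<And>x. x \<in> ?O \<Longrightarrow> \<exists>d. has_divergence (\<lambda>y. (norm (g y) powr (real r + 1 - 2)) *\<^sub>R g y) d x \<and>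
                     - d = lam * (\<bar>u x\<bar> powr (real r + 1 - 2) * u x)"
    using u(1) unfolding p_laplace_dirichlet_solution_def by blast
  obtain e :: 'a where e: "e \<in> Basis" using nonempty_Basis by blast
  then have ne: "norm e = 1" "e \<bullet> e = 1" by auto
  define v where "v = (\<lambda>t. u (t *\<^sub>R e))"
  define v1 where "v1 = (\<lambda>t. e \<bullet> g (t *\<^sub>R e))"
  have inO: "t *\<^sub>R e \<in> ?O" if "R < t" "t < S" for t
    using that RS ne by (simp add: annulus_def)
  have uv: "u x = v (norm x)" if "x \<in> ?O" for x
  proof -
    have "norm x *\<^sub>R e \<in> ?O" using that by (intro inO) (auto simp: annulus_def)
    then show ?thesis
      using u(2) that ne unfolding radial_on_def v_def by (metis norm_scaleR abs_norm_cancel mult.right_neutral)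
  qed
  have vd: "(v has_real_derivative v1 t) (at t)" if t: "R < t" "t < S" for t
  proof -
    have "(u has_derivative (\<lambda>h. h \<bullet> g (t *\<^sub>R e))) (at (t *\<^sub>R e))"
      using g[OF inO[OF t]] by (simp add: gderiv_def)
    moreover have "((\<lambda>t. t *\<^sub>R e) has_derivative (\<lambda>h. h *\<^sub>R e)) (at t)"
      by (auto intro!: derivative_eq_intros)
    ultimately have "(v has_derivative (\<lambda>h. (h *\<^sub>R e) \<bullet> g (t *\<^sub>R e))) (at t)"
      unfolding v_def using has_derivative_compose by blast
    then show ?thesis
      unfolding has_field_derivative_def by (rule has_derivative_eq_rhs) (simp add: v1_def fun_eq_iff)
  qed
  have nzO: "x \<noteq> 0" if "x \<in> ?O" for x using that RS by (auto simp: annulus_def)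
  have g_eq: "g x = (v1 (norm x) / norm x) *\<^sub>R x" if x: "x \<in> ?O" for x
  proof (rule gderiv_unique[OF g[OF x]])
    have "GDERIV (\<lambda>y. v (norm y)) x :> (v1 (norm x) / norm x) *\<^sub>R x"
      using x by (intro gderiv_radial vd nzO) (auto simp: annulus_def)
    then show "GDERIV u x :> (v1 (norm x) / norm x) *\<^sub>R x"
      unfolding gderiv_def
      by (rule has_derivative_transform_within_open[OF _ open_annulus x]) (simp add: uv)
  qed
  define F where "F = (\<lambda>y. (norm (g y) powr (real r + 1 - 2)) *\<^sub>R g y)"
  define w where "w = (\<lambda>t. phi r (v1 t))"
  have F_eq: "F y = (w (norm y) / norm y) *\<^sub>R y" if "y \<in> ?O" for y
    unfolding F_def w_def by (rule norm_powr_scaleR_radial[OF r nzO[OF that] g_eq[OF that]])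
  have wd: "\<exists>w'. (w has_real_derivative w') (at t) \<and> - (w' + 2 * real r * w t / t) = lam * phi r (v t)"
    if t: "R < t" "t < S" for t
  proof -
    let ?x = "t *\<^sub>R e"
    have nx: "norm ?x = t" using ne t RS by simp
    obtain d where d: "has_divergence F d ?x" "- d = lam * phi r (v t)"
      using dv[OF inO[OF t]] unfolding F_def v_def abs_powr_mult_eq_phi[OF r] by blast
    \<comment> \<open>Only the vector field F is known to be differentiable; differentiating its
      e-component along the ray yields the derivative of the scalar flux w.\<close>
    then obtain F' where F': "(F has_derivative F') (at ?x)" by (auto simp: has_divergence_def)
    have lin: "F' (h *\<^sub>R e) = h *\<^sub>R F' e" for h
      using has_derivative_linear[OF F'] by (rule linear_scale)
    have "((\<lambda>t. t *\<^sub>R e) has_derivative (\<lambda>h. h *\<^sub>R e)) (at t)"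
      by (auto intro!: derivative_eq_intros)
    from has_derivative_compose[OF this F']
    have "((\<lambda>t. F (t *\<^sub>R e) \<bullet> e) has_derivative (\<lambda>h. (h *\<^sub>R F' e) \<bullet> e)) (at t)"
      unfolding lin by (rule has_derivative_inner_left)
    then have "((\<lambda>t. F (t *\<^sub>R e) \<bullet> e) has_real_derivative F' e \<bullet> e) (at t)"
      unfolding has_field_derivative_def by (rule has_derivative_eq_rhs) (simp add: fun_eq_iff)
    then have w': "(w has_real_derivative F' e \<bullet> e) (at t)"
      by (rule has_field_derivative_transform_within_open[where S = "{R<..<S}"])
        (use t RS ne inO in \<open>auto simp: F_eq\<close>)
    have "has_divergence (\<lambda>y. (w (norm y) / norm y) *\<^sub>R y)
        (F' e \<bullet> e + (real DIM('a) - 1) * w (norm ?x) / norm ?x) ?x"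
      using w' nx by (intro has_divergence_radial) (use ne t RS in auto)
    then have "has_divergence F (F' e \<bullet> e + (real DIM('a) - 1) * w (norm ?x) / norm ?x) ?x"
      by (rule has_divergence_transform[OF _ open_annulus inO[OF t]]) (simp add: F_eq)
    then have "d = F' e \<bullet> e + (real DIM('a) - 1) * w (norm ?x) / norm ?x"
      using has_divergence_unique d(1) by blast
    then have "d = F' e \<bullet> e + 2 * real r * w t / t" by (simp only: nx dim) simp
    then show ?thesis using w' d(2) by blast
  qed
  have vc: "continuous_on {R..S} v"
    unfolding v_def
    by (rule continuous_on_compose2[OF uc]) (use RS ne in \<open>auto simp: closure_annulus intro!: continuous_intros\<close>)
  define z where "z = (\<lambda>t. coef_b r R t * w t)"
  define f where "f = (\<lambda>t. - lam * coef_b r R t * phi r (v t))"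
  have zd: "(z has_real_derivative f t) (at t)" if t: "R < t" "t < S" for t
  proof -
    obtain w' where w': "(w has_real_derivative w') (at t)" "- (w' + 2 * real r * w t / t) = lam * phi r (v t)"
      using wd[OF t] by blast
    have "t > 0" using t RS by simp
    have "(z has_real_derivative coef_b r R t * (2 * real r / t) * w t + w' * coef_b r R t) (at t)"
      unfolding z_def by (rule DERIV_mult[OF DERIV_coef_b[OF r RS(1) \<open>t > 0\<close>] w'(1)])
    moreover have "coef_b r R t * (2 * real r / t) * w t + w' * coef_b r R t
        = - coef_b r R t * (- (w' + 2 * real r * w t / t))"
      by (simp add: algebra_simps)
    ultimately show ?thesis by (simp only: w'(2) f_def) (simp add: mult_ac)
  qed
  have fc: "continuous_on {R..S} f" unfolding f_def by (intro continuous_intros vc) (use RS in auto)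
  obtain zz where zz: "continuous_on {R..S} zz" "\<And>t. R < t \<Longrightarrow> t < S \<Longrightarrow> zz t = z t"
    using continuous_extension_of_primitive[OF RS(2) fc zd] by metis
  have "sol lam v zz"
    unfolding sol_def
  proof (intro conjI ballI vc zz(1))
    fix t assume "t \<in> {R<..<S}"
    then have t: "R < t" "t < S" "t > 0" using RS by auto
    have "coef_a R t * root r (zz t) = v1 t"
      using radial_flux_unscale(2)[OF r RS(1) t(3)] zz(2)[OF t(1,2)] by (simp only: z_def w_def)
    then show "(v has_real_derivative coef_a R t * root r (zz t)) (at t)" using vd[OF t(1,2)] by simp
    show "(zz has_real_derivative - lam * coef_b r R t * phi r (v t)) (at t)"
      using zd[OF t(1,2)] unfolding f_def
      by (rule has_field_derivative_transform_within_open[where S = "{R<..<S}"]) (use t zz(2) in auto)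
  qed
  moreover have "v R = 0" "v S = 0"
    using u0[of "R *\<^sub>R e"] u0[of "S *\<^sub>R e"] RS ne by (auto simp: v_def frontier_annulus)
  moreover have "\<exists>t\<in>{R<..<S}. v t \<noteq> 0"
    using u(3) uv by (force simp: annulus_def)
  ultimately show ?thesis unfolding eig_def by blast
qed

text \<open>The flux phi r v' equals w = z / b and is differentiable by the quotient rule, even
  where v' vanishes and the root in its formula is not differentiable.\<close>

lemma eig_imp_radial_eigenvalue:
  assumes r: "r \<ge> 1" and RS: "0 < R" "R < S" and dim: "DIM('a::euclidean_space) = 2 * r + 1"
    and lam: "half_linear.eig r R S (coef_a R) (coef_b r R) lam"
  shows "lam \<in> radial_eigenvalues TYPE('a) (real r + 1) R S"
proof -
  interpret half_linear r R S "coef_a R" "coef_b r R" using half_linear_radial[OF r RS] .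
  let ?O = "annulus R S :: 'a set"
  obtain v z t0 where S: "sol lam v z" "v R = 0" "v S = 0" "t0 \<in> {R<..<S}" "v t0 \<noteq> 0"
    using lam by (auto simp: eig_def)
  note S' = solD[OF S(1)]
  define u where "u = (\<lambda>x::'a. v (norm x))"
  define v1 where "v1 = (\<lambda>t. coef_a R t * root r (z t))"
  define g where "g = (\<lambda>x::'a. (v1 (norm x) / norm x) *\<^sub>R x)"
  define w where "w = (\<lambda>t. z t / coef_b r R t)"
  have O: "R < norm x" "norm x < S" "norm x > 0" "x \<noteq> 0" if "x \<in> ?O" for x
    using that RS by (auto simp: annulus_def)
  have uc: "continuous_on (closure ?O) u"
    unfolding u_def closure_annulus[OF RS]
    by (rule continuous_on_compose2[OF S'(1)]) (auto intro!: continuous_intros)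
  have "continuous_on {R..S} v1"
    unfolding v1_def using RS by (intro continuous_intros S'(2)) auto
  then have "continuous_on ?O (\<lambda>x. v1 (norm x))"
    by (rule continuous_on_compose2) (auto intro!: continuous_intros simp: annulus_def)
  then have gc: "continuous_on ?O g"
    unfolding g_def using O by (intro continuous_intros) auto
  have gd: "GDERIV u x :> g x" if x: "x \<in> ?O" for x
    unfolding u_def g_def v1_def by (intro gderiv_radial S'(3) O x)
  have flux: "(norm (g y) powr (real r + 1 - 2)) *\<^sub>R g y = (w (norm y) / norm y) *\<^sub>R y" if y: "y \<in> ?O" for y
    using norm_powr_scaleR_radial[OF r O(4)[OF y] g_def[THEN fun_cong]]
    unfolding v1_def radial_flux_unscale(1)[OF r RS(1) O(3)[OF y]] w_def .
  have dv: "has_divergence (\<lambda>y. (norm (g y) powr (real r + 1 - 2)) *\<^sub>R g y) (- (lam * phi r (u x))) x"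
    if x: "x \<in> ?O" for x
  proof -
    define t where "t = norm x"
    have t: "R < t" "t < S" "t > 0" using O[OF x] by (auto simp: t_def)
    have b0: "coef_b r R t > 0" "coef_b r R t \<noteq> 0" using t RS by simp_all
    define w' where "w' = (- lam * coef_b r R t * phi r (v t) * coef_b r R t
        - z t * (coef_b r R t * (2 * real r / t))) / (coef_b r R t * coef_b r R t)"
    have "(w has_real_derivative w') (at t)"
      unfolding w_def w'_def
      by (rule DERIV_divide[OF S'(4)[OF t(1,2)] DERIV_coef_b[OF r RS(1) t(3)] b0(2)])
    then have "has_divergence (\<lambda>y. (w (norm y) / norm y) *\<^sub>R y) (w' + (real DIM('a) - 1) * w t / t) x"
      unfolding t_def by (intro has_divergence_radial O(4)[OF x])
    moreover have "w' + (real DIM('a) - 1) * w t / t = - (lam * phi r (u x))"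
    proof -
      have "(- lam * c * q * c - zt * (c * (n / t))) / (c * c) + n * (zt / c) / t = - (lam * q)"
        if "c > 0" for c q zt n :: real
        using that t(3) by (simp add: field_simps)
      from this[OF b0(1), of "phi r (v t)" "z t" "2 * real r"]
      show ?thesis by (simp add: w'_def w_def dim u_def t_def)
    qed
    ultimately have "has_divergence (\<lambda>y. (w (norm y) / norm y) *\<^sub>R y) (- (lam * phi r (u x))) x" by simp
    then show ?thesis
      by (rule has_divergence_transform[OF _ open_annulus x]) (rule flux[symmetric])
  qed
  have "p_laplace_dirichlet_solution (real r + 1) lam ?O u"
    unfolding p_laplace_dirichlet_solution_def abs_powr_mult_eq_phi[OF r]
  proof (intro conjI ballI exI[of _ g])
    fix x assume "x \<in> ?O"
    from dv[OF this] show "\<exists>d. has_divergence (\<lambda>y. (norm (g y) powr (real r + 1 - 2)) *\<^sub>R g y) d x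
      \<and> - d = lam * phi r (u x)" by (intro exI[of _ "- (lam * phi r (u x))"]) simp
  qed (use uc gc gd S RS in \<open>auto simp: frontier_annulus u_def\<close>)
  moreover have "radial_on ?O u" by (simp add: radial_on_def u_def)
  moreover have "\<exists>x\<in>?O. u x \<noteq> 0"
  proof -
    obtain e :: 'a where "e \<in> Basis" using nonempty_Basis by blast
    then show ?thesis using S RS
      by (intro bexI[of _ "t0 *\<^sub>R e"]) (auto simp: u_def annulus_def)
  qed
  ultimately show ?thesis unfolding radial_eigenvalues_def by blast
qed

section \<open>Limits for thin annuli\<close>

lemma radial_eigenvalue_eqI:
  assumes mono: "strict_mono_on {1..} mu" and E: "radial_eigenvalues T p R S = mu ` {1..}" and k: "k \<ge> 1"
  shows "radial_eigenvalue T p k R S = mu k"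
proof -
  \<comment> \<open>Strict monotonicity leaves exactly the j - 1 values with indices 1 to j - 1
    below mu j, which fixes both the index and the \<open>Suc\<close> in the count.\<close>
  have below: "{x \<in> radial_eigenvalues T p R S. x < mu j} = mu ` {1..<j}" if "j \<ge> 1" for j
    using that mono unfolding E by (auto simp: strict_mono_on_less)
  have card: "card (mu ` {1..<j}) = j - 1" for j
    by (subst card_image) (auto intro: inj_on_subset[OF strict_mono_on_imp_inj_on[OF mono]])
  show ?thesis
    unfolding radial_eigenvalue_def
  proof (rule the_equality)
    show "mu k \<in> radial_eigenvalues T p R S \<and> finite {x \<in> radial_eigenvalues T p R S. x < mu k} \<and>
        Suc (card {x \<in> radial_eigenvalues T p R S. x < mu k}) = k"
      unfolding below[OF k] card using k E by auto
    fix lam assume l: "lam \<in> radial_eigenvalues T p R S \<and> finite {x \<in> radial_eigenvalues T p R S. x < lam} \<and>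
        Suc (card {x \<in> radial_eigenvalues T p R S. x < lam}) = k"
    then obtain j where j: "j \<ge> 1" "lam = mu j" unfolding E by auto
    from l show "lam = mu k" unfolding j(2) below[OF j(1)] card using j(1) by auto
  qed
qed

lemma radial_eigenvalue_bounds:
  assumes r: "r \<ge> 1" and R: "R > 0" and dim: "DIM('a::euclidean_space) = 2 * r + 1" and k: "k \<ge> 1"
  defines "w \<equiv> real k * (2 * pi / ((real r + 1) * sin (pi / (real r + 1))))"
  shows "r * (w / ((R + 1) / R) ^ (2 * r)) ^ (r + 1) \<le> radial_eigenvalue TYPE('a) (real r + 1) k R (R + 1)"
    "radial_eigenvalue TYPE('a) (real r + 1) k R (R + 1) \<le> r * (w / (R / (R + 1))\<^sup>2) ^ (r + 1)"
proof -
  have RS: "R < R + 1" by simp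
  interpret half_linear r R "R + 1" "coef_a R" "coef_b r R" using half_linear_radial[OF r R RS] .
  \<comment> \<open>On [R, R + 1] one has a \<le> 1 \<le> b, and both coefficients are farthest from
    1 at the outer radius; hence lo is a there and hi is b there.\<close>
  define lo where "lo = (R / (R + 1))\<^sup>2"
  define hi where "hi = ((R + 1) / R) ^ (2 * r)"
  have one: "lo \<le> 1" "1 \<le> hi" "0 < lo"
    unfolding lo_def hi_def using R by (auto intro!: power_le_one one_le_power simp del: one_le_power)
  have a: "lo \<le> coef_a R t" "coef_a R t \<le> 1" if "t \<in> {R..R + 1}" for t
    unfolding lo_def using R that by (auto intro!: power_mono divide_left_mono power_le_one)
  have b: "1 \<le> coef_b r R t" "coef_b r R t \<le> hi" if "t \<in> {R..R + 1}" for t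
    unfolding hi_def using R that by (auto intro!: power_mono divide_right_mono one_le_power)
  have loab: "lo \<le> coef_a R t \<and> lo \<le> coef_b r R t" and hiab: "coef_a R t \<le> hi \<and> coef_b r R t \<le> hi"
    if "t \<in> {R..R + 1}" for t
    using a[OF that] b[OF that] one by linarith+
  obtain mu where mu: "strict_mono_on {1..} mu" "Collect eig = mu ` {1..}"
    "\<And>k. k \<ge> 1 \<Longrightarrow> r * (real k * (2 * pi / ((real r + 1) * sin (pi / (real r + 1)))) / (hi * (R + 1 - R))) ^ (r + 1) \<le> mu k"
    "\<And>k. k \<ge> 1 \<Longrightarrow> mu k \<le> r * (real k * (2 * pi / ((real r + 1) * sin (pi / (real r + 1)))) / (lo * (R + 1 - R))) ^ (r + 1)"
    using eig_structure[OF one(3) loab hiab] by metis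
  have "radial_eigenvalues TYPE('a) (real r + 1) R (R + 1) = Collect eig"
    using radial_eigenvalue_imp_eig[OF r R RS dim] eig_imp_radial_eigenvalue[OF r R RS dim] by blast
  then have "radial_eigenvalue TYPE('a) (real r + 1) k R (R + 1) = mu k"
    using mu(1,2) k by (intro radial_eigenvalue_eqI) auto
  then show "r * (w / ((R + 1) / R) ^ (2 * r)) ^ (r + 1) \<le> radial_eigenvalue TYPE('a) (real r + 1) k R (R + 1)"
    "radial_eigenvalue TYPE('a) (real r + 1) k R (R + 1) \<le> r * (w / (R / (R + 1))\<^sup>2) ^ (r + 1)"
    using mu(3,4)[OF k] by (simp_all only: w_def lo_def hi_def add_diff_cancel_left' mult_1_right)
qed

lemma tendsto_ratio_at_top:
  "((\<lambda>R::real. (R + 1) / R) \<longlongrightarrow> 1) at_top" "((\<lambda>R::real. R / (R + 1)) \<longlongrightarrow> 1) at_top"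
proof -
  have "((\<lambda>R::real. 1 + inverse R) \<longlongrightarrow> 1 + 0) at_top"
    by (intro tendsto_intros tendsto_inverse_0_at_top filterlim_ident)
  then have "((\<lambda>R::real. 1 + inverse R) \<longlongrightarrow> 1) at_top" by simp
  then show *: "((\<lambda>R::real. (R + 1) / R) \<longlongrightarrow> 1) at_top"
    by (rule Lim_transform_eventually)
      (use eventually_gt_at_top[of 0] in eventually_elim, simp add: field_simps)
  show "((\<lambda>R::real. R / (R + 1)) \<longlongrightarrow> 1) at_top"
    using tendsto_inverse[OF *] by (simp add: inverse_divide)
qed

text \<open>Raised to the power p, the factor (p-1)^(1/p) of pi_p becomes the factor r in \<lambda>
  = r m^(r+1).\<close>

lemma pi_p_power:
  assumes r: "r \<ge> 1"
  shows "(real k * pi_p (real r + 1)) ^ (r + 1)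
    = real r * (real k * (2 * pi / ((real r + 1) * sin (pi / (real r + 1))))) ^ (r + 1)"
proof -
  have rp: "(real r powr (1 / (real r + 1))) ^ (r + 1) = real r"
    using r by (simp add: powr_powr add.commute flip: powr_realpow del: power_Suc)
  have "real k * pi_p (real r + 1)
      = (real k * (2 * pi / ((real r + 1) * sin (pi / (real r + 1))))) * real r powr (1 / (real r + 1))"
    by (simp add: pi_p_def)
  moreover have "(x * real r powr (1 / (real r + 1))) ^ (r + 1) = real r * x ^ (r + 1)" for x
    unfolding power_mult_distrib rp by (rule mult.commute)
  ultimately show ?thesis by (simp only:)
qed

lemma radial_eigenvalue_tendsto:
  assumes r: "r \<ge> 1" and dim: "DIM('a::euclidean_space) = 2 * r + 1" and k: "k \<ge> 1"
  shows "((\<lambda>R. radial_eigenvalue TYPE('a) (real r + 1) k R (R + 1))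
    \<longlongrightarrow> (real k * pi_p (real r + 1)) ^ (r + 1)) at_top"
proof (rule tendsto_sandwich)
  define w where "w = real k * (2 * pi / ((real r + 1) * sin (pi / (real r + 1))))"
  note bounds = radial_eigenvalue_bounds[OF r _ dim k, folded w_def]
  show "\<forall>\<^sub>F R in at_top. r * (w / ((R + 1) / R) ^ (2 * r)) ^ (r + 1)
      \<le> radial_eigenvalue TYPE('a) (real r + 1) k R (R + 1)"
    using eventually_gt_at_top[of 0] by eventually_elim (rule bounds(1))
  show "\<forall>\<^sub>F R in at_top. radial_eigenvalue TYPE('a) (real r + 1) k R (R + 1)
      \<le> r * (w / (R / (R + 1))\<^sup>2) ^ (r + 1)"
    using eventually_gt_at_top[of 0] by eventually_elim (rule bounds(2))
  have "((\<lambda>R. r * (w / ((R + 1) / R) ^ (2 * r)) ^ (r + 1)) \<longlongrightarrow> r * (w / 1 ^ (2 * r)) ^ (r + 1)) at_top"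
    by (intro tendsto_intros tendsto_ratio_at_top) simp
  then show "((\<lambda>R. r * (w / ((R + 1) / R) ^ (2 * r)) ^ (r + 1))
      \<longlongrightarrow> (real k * pi_p (real r + 1)) ^ (r + 1)) at_top"
    unfolding pi_p_power[OF r] w_def by simp
  have "((\<lambda>R. r * (w / (R / (R + 1))\<^sup>2) ^ (r + 1)) \<longlongrightarrow> r * (w / 1\<^sup>2) ^ (r + 1)) at_top"
    by (intro tendsto_intros tendsto_ratio_at_top) simp
  then show "((\<lambda>R. r * (w / (R / (R + 1))\<^sup>2) ^ (r + 1))
      \<longlongrightarrow> (real k * pi_p (real r + 1)) ^ (r + 1)) at_top"
    unfolding pi_p_power[OF r] w_def by simp
qed

section \<open>Limits of the averaged weights\<close>

lemma weight_q_eq: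
  assumes r: "r \<ge> 1" and R: "R > 0" and t: "t \<in> {0..1}"
  shows "weight_q (2 * real r + 1) (real r + 1) R (R + 1) t = (R * (R + 1) / (R + 1 - t)\<^sup>2) ^ (r + 1)"
proof -
  \<comment> \<open>Here (N - p) / (p - 1) = 1 and the annulus has width 1, so the denominators of A
    and B equal 1 and the exponents in the weight become the integers r + 1 and 2 (r + 1).\<close>
  have e: "2 * real r + 1 - (real r + 1) = real r" "real r + 1 - 1 = real r" "2 * real r + 1 - 1 = 2 * real r"
    "real r / real r = 1" "real r * (real r + 1) / real r = real (r + 1)"
    "(real r + 1) * (2 * real r) / real r = real (2 * (r + 1))"
    using r by auto
  have AB: "weight_A (2 * real r + 1) (real r + 1) R (R + 1) = R * (R + 1)"
    "weight_B (2 * real r + 1) (real r + 1) R (R + 1) = R + 1"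
    unfolding weight_A_def weight_B_def e using R by simp_all
  have p: "R * (R + 1) > 0" "R + 1 - t > 0" using R t by auto
  show ?thesis
    unfolding weight_q_def AB e powr_realpow[OF p(1)] powr_realpow[OF p(2)]
    by (simp only: powr_one_eq_one mult_1 power_divide flip: power_mult)
qed

lemma weight_q_bounds:
  assumes r: "r \<ge> 1" and R: "R > 0" and t: "t \<in> {0..1}"
  shows "(R / (R + 1)) ^ (r + 1) \<le> weight_q (2 * real r + 1) (real r + 1) R (R + 1) t"
    "weight_q (2 * real r + 1) (real r + 1) R (R + 1) t \<le> ((R + 1) / R) ^ (r + 1)"
proof -
  have p: "0 < R + 1 - t" "R \<le> R + 1 - t" "R + 1 - t \<le> R + 1" using R t by auto
  have "R / (R + 1) = R * (R + 1) / (R + 1)\<^sup>2" using R by (simp add: power2_eq_square)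
  also have "\<dots> \<le> R * (R + 1) / (R + 1 - t)\<^sup>2"
    using R p by (intro divide_left_mono power_mono mult_pos_pos) auto
  finally have 1: "R / (R + 1) \<le> R * (R + 1) / (R + 1 - t)\<^sup>2" .
  have "R * (R + 1) / (R + 1 - t)\<^sup>2 \<le> R * (R + 1) / R\<^sup>2"
    using R p by (intro divide_left_mono power_mono mult_pos_pos) auto
  also have "\<dots> = (R + 1) / R" using R by (simp add: power2_eq_square)
  finally have 2: "R * (R + 1) / (R + 1 - t)\<^sup>2 \<le> (R + 1) / R" .
  show "(R / (R + 1)) ^ (r + 1) \<le> weight_q (2 * real r + 1) (real r + 1) R (R + 1) t"
    "weight_q (2 * real r + 1) (real r + 1) R (R + 1) t \<le> ((R + 1) / R) ^ (r + 1)"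
    unfolding weight_q_eq[OF assms] using R by (intro power_mono 1 2; simp)+
qed

lemma continuous_on_weight_q:
  assumes r: "r \<ge> 1" and R: "R > 0"
  shows "continuous_on {0..1} (weight_q (2 * real r + 1) (real r + 1) R (R + 1))"
proof -
  have "continuous_on {0..1} (\<lambda>t. (R * (R + 1) / (R + 1 - t)\<^sup>2) ^ (r + 1))"
    using R by (intro continuous_intros) auto
  then show ?thesis
    by (rule continuous_on_eq) (simp only: weight_q_eq[OF r R])
qed

lemma integral_unit_bounds:
  fixes f :: "real \<Rightarrow> real"
  assumes "continuous_on {0..1} f"
  shows "(\<And>t. t \<in> {0..1} \<Longrightarrow> c \<le> f t) \<Longrightarrow> c \<le> integral {0..1} f"
    "(\<And>t. t \<in> {0..1} \<Longrightarrow> f t \<le> d) \<Longrightarrow> integral {0..1} f \<le> d"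
proof -
  have i: "f integrable_on {0..1}" by (rule integrable_continuous_interval[OF assms])
  show "c \<le> integral {0..1} f" if "\<And>t. t \<in> {0..1} \<Longrightarrow> c \<le> f t"
    using integral_le[OF integrable_const_ivl i, of c] that by simp
  show "integral {0..1} f \<le> d" if "\<And>t. t \<in> {0..1} \<Longrightarrow> f t \<le> d"
    using integral_le[OF i integrable_const_ivl, of d] that by simp
qed

lemma q_plus_tendsto:
  assumes r: "r \<ge> 1"
  shows "((\<lambda>R. q_plus (2 * real r + 1) (real r + 1) R (R + 1)) \<longlongrightarrow> 1) at_top"
proof (rule tendsto_sandwich)
  let ?q = "\<lambda>R. q_plus (2 * real r + 1) (real r + 1) R (R + 1)"
  have b: "1 \<le> ?q R" "?q R \<le> ((R + 1) / R) ^ (r + 1)" if "R > 0" for R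
  proof -
    have "1 \<le> ((R + 1) / R) ^ (r + 1)" using that by (intro one_le_power) simp
    then have "max 1 (weight_q (2 * real r + 1) (real r + 1) R (R + 1) t) \<le> ((R + 1) / R) ^ (r + 1)"
      if "t \<in> {0..1}" for t
      using weight_q_bounds(2)[OF r \<open>R > 0\<close> that] by (rule max.boundedI)
    moreover have "continuous_on {0..1} (\<lambda>t. max 1 (weight_q (2 * real r + 1) (real r + 1) R (R + 1) t))"
      by (intro continuous_intros continuous_on_weight_q r that)
    ultimately show "1 \<le> ?q R" "?q R \<le> ((R + 1) / R) ^ (r + 1)"
      unfolding q_plus_def by (auto intro!: integral_unit_bounds simp only: max.cobounded1)
  qed
  show "\<forall>\<^sub>F R in at_top. 1 \<le> ?q R" "\<forall>\<^sub>F R in at_top. ?q R \<le> ((R + 1) / R) ^ (r + 1)"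
    by (rule eventually_mono[OF eventually_gt_at_top[of 0]], erule b)+
  show "((\<lambda>R. ((R + 1) / R) ^ (r + 1)) \<longlongrightarrow> (1::real)) at_top"
    using tendsto_power[OF tendsto_ratio_at_top(1), of "r + 1"] by simp
qed simp

lemma q_minus_tendsto:
  assumes r: "r \<ge> 1"
  shows "((\<lambda>R. q_minus (2 * real r + 1) (real r + 1) R (R + 1)) \<longlongrightarrow> 1) at_top"
proof (rule tendsto_sandwich)
  let ?q = "\<lambda>R. q_minus (2 * real r + 1) (real r + 1) R (R + 1)"
  have b: "(R / (R + 1)) ^ (r + 1) \<le> ?q R" "?q R \<le> 1" if "R > 0" for R
  proof -
    have "(R / (R + 1)) ^ (r + 1) \<le> 1" using that by (intro power_le_one) auto
    then have "(R / (R + 1)) ^ (r + 1) \<le> min 1 (weight_q (2 * real r + 1) (real r + 1) R (R + 1) t)"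
      if "t \<in> {0..1}" for t
      using weight_q_bounds(1)[OF r \<open>R > 0\<close> that] by (rule min.boundedI)
    moreover have "continuous_on {0..1} (\<lambda>t. min 1 (weight_q (2 * real r + 1) (real r + 1) R (R + 1) t))"
      by (intro continuous_intros continuous_on_weight_q r that)
    ultimately show "(R / (R + 1)) ^ (r + 1) \<le> ?q R" "?q R \<le> 1"
      unfolding q_minus_def by (auto intro!: integral_unit_bounds simp only: min.cobounded1)
  qed
  show "\<forall>\<^sub>F R in at_top. (R / (R + 1)) ^ (r + 1) \<le> ?q R" "\<forall>\<^sub>F R in at_top. ?q R \<le> 1"
    by (rule eventually_mono[OF eventually_gt_at_top[of 0]], erule b)+
  show "((\<lambda>R. (R / (R + 1)) ^ (r + 1)) \<longlongrightarrow> (1::real)) at_top"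
    using tendsto_power[OF tendsto_ratio_at_top(2), of "r + 1"] by simp
qed simp

theorem mainTheorem2:
  fixes r :: nat and p N :: real
  assumes "r \<ge> 1"
    and "p = real r + 1"
    and "CARD('n::finite) = 2 * r + 1"
    and "N = real CARD('n)"
  shows "((\<lambda>R. q_plus N p R (R + 1)) \<longlongrightarrow> 1) at_top
       \<and> ((\<lambda>R. q_minus N p R (R + 1)) \<longlongrightarrow> 1) at_top
       \<and> (\<forall>k\<ge>1. ((\<lambda>R. radial_eigenvalue TYPE(real ^ 'n) p k R (R + 1))
                    \<longlongrightarrow> (real k * pi_p p) powr p) at_top
              \<and> (real k * pi_p p) powr p = (pi_p (real r + 1) * real k) ^ (r + 1))"
proof -
  have N: "N = 2 * real r + 1" using assms by simp
  \<comment> \<open>The real power agrees with the natural power only for a nonnegative base, so the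
    sign of pi_p has to be settled.\<close>
  have "0 \<le> sin (pi / (real r + 1))"
    using assms(1) by (intro sin_ge_zero) (auto simp: divide_le_eq)
  then have "0 \<le> pi_p p" unfolding assms(2) by (simp add: pi_p_def)
  then have pw: "(real k * pi_p p) powr p = (real k * pi_p (real r + 1)) ^ (r + 1)" for k
    using powr_realpow'[of "real k * pi_p p" "r + 1"] assms(2) by (simp add: add.commute del: power_Suc)
  have dim: "DIM(real ^ 'n) = 2 * r + 1" using assms(3) by simp
  show ?thesis
  proof (intro conjI allI impI)
    show "((\<lambda>R. q_plus N p R (R + 1)) \<longlongrightarrow> 1) at_top" "((\<lambda>R. q_minus N p R (R + 1)) \<longlongrightarrow> 1) at_top"
      unfolding N assms(2) by (rule q_plus_tendsto q_minus_tendsto, rule assms(1))+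
    fix k :: nat assume "k \<ge> 1"
    then show "((\<lambda>R. radial_eigenvalue TYPE(real ^ 'n) p k R (R + 1)) \<longlongrightarrow> (real k * pi_p p) powr p) at_top"
      unfolding pw unfolding assms(2) by (rule radial_eigenvalue_tendsto[OF assms(1) dim])
    show "(real k * pi_p p) powr p = (pi_p (real r + 1) * real k) ^ (r + 1)"
      unfolding pw by (simp only: mult.commute)
  qed
qed

end
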